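(* Let $R = R_0[x_1,\ldots,x_d]$ be a commutative Noetherian $\mathbb{N}$-graded algebra, where $R_0$ is the degree-$0$ component of $R$ and the $x_i$ are homogeneous with $\deg(x_i)\ge 1$ for $1\le i\le d$. Let $M$ be a finitely generated $\mathbb{Z}$-graded $R$-module, $N$ a graded submodule of $M$, and $I$ a homogeneous ideal of $R$. Let $J$ be a reduction ideal of $I$ (possibly $J=I$), generated by homogeneous elements $y_1,\ldots,y_c$ of degrees $d_1\le\cdots\le d_c$ respectively. Let $\mathscr{H} := \mathscr{R}(I,M)/\mathscr{R}(I,N)=\bigoplus_{n\ge0}I^nM/I^nN$, regarded as a module over the Rees algebra $\mathscr{R}(J)$, and set $$\delta:=\inf\left\{j : y_j\notin\sqrt{\mathrm{ann}_{\mathscr{R}(J)}(\mathscr{H})},\ 1 \le j \le c \right\}.$$ Let $\mathcal{B}_N^M(I)$ be a non-empty set. Then, for every $\mathfrak{p}\in\mathcal{B}_N^M(I)$, there exist $a\in\{d_\delta,\ldots,d_c\}$ and $b\in\mathbb{Z}$ such that $v_{\mathfrak{p}}(I^nM/I^nN) = an+b$ for all $n\gg 0$. Furthermore, both the functions $\mathrm{indeg}(I^nM/I^nN)$ and $v(I^nM/I^nN)$ are eventually linear in $n$ with the same leading coefficient $d_{\delta}\in \{d_1,\ldots,d_c\}$.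
   Context: For a finitely generated $\mathbb{Z}$-graded $R$-module $L=\bigoplus_{u}L_u$: $\mathrm{indeg}(L) := \inf\{n : L_n\neq 0\}$, with $\mathrm{indeg}(0)=\infty$. For $\mathfrak{p}\in\mathrm{Ass}_R(L)$, the v-number of $L$ at $\mathfrak{p}$ is $v_{\mathfrak{p}}(L) := \inf\{ u : \text{there exists } x\in L_u \text{ such that } \mathfrak{p} = (0:_R x)\}$. The v-number of $L$ is $v(L) := \inf\{v_{\mathfrak{p}}(L) : \mathfrak{p}\in\mathrm{Ass}_R(L)\}$, with $v(0)=\infty$. It is known that the set $\mathrm{Ass}_R(I^nM/I^nN)$ is the same for all $n\gg 0$; $\mathcal{B}_N^M(I) := \mathrm{Ass}_R(I^nM/I^nN)$ for all $n\gg0$ denotes this eventual set. The Rees algebra of $J$ is $\mathscr{R}(J)=\bigoplus_{n\in\mathbb{N}}J^n$, and $\mathscr{R}(I,M)=\bigoplus_{n\in\mathbb{N}}I^nM$, $\mathscr{R}(I,N)=\bigoplus_{n\in\mathbb{N}}I^nN$ are the Rees modules, viewed as $\mathscr{R}(J)$-modules (an element of the $m$th summand $J^m$ maps $I^nM$ to $I^{n+m}M$). One writes $\mathscr{R}(J)=R_0[x_1,\ldots,x_d,y_1,\ldots,y_c]$ with $x_i$ in the summand $J^0=R$ and, in $\mathscr{R}(J)$, $y_j$ standing for the element $y_j$ of the summand $J^1$ (so multiplication by $y_j$ maps $I^nM/I^nN$ to $I^{n+1}M/I^{n+1}N$). An ideal $J\subseteq I$ is a reduction of $I$ if $JI^m=I^{m+1}$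 for some $m\ge 0$. A function $f(n)$ is eventually linear with leading coefficient $a$ if there is $b\in\mathbb{Z}$ with $f(n)=an+b$ for all $n\gg 0$. *)

theory Defs
  imports
    "HOL-Library.Extended_Real"
    "HOL-Library.Poly_Mapping"
    "HOL-Computational_Algebra.Polynomial"
begin

section \<open>Ideals, products and powers\<close>

text \<open>The ring is a whole type, acting on itself by multiplication; its ideals are the
  submodules of that module.\<close>

abbreviation ideal :: "'a::comm_ring_1 set \<Rightarrow> bool"
  where "ideal \<equiv> module.subspace (*)"

abbreviation ideal_gen :: "'a::comm_ring_1 set \<Rightarrow> 'a set"
  where "ideal_gen \<equiv> module.span (*)"

definition prime_ideal :: "'a::comm_ring_1 set \<Rightarrow> bool"
  where "prime_ideal P \<longleftrightarrow>
    ideal P \<and> P \<noteq> UNIV \<and> (\<forall>a b. a * b \<in> P \<longrightarrow> a \<in> P \<or> b \<in> P)"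

definition noetherian :: "'a::comm_ring_1 itself \<Rightarrow> bool"
  where "noetherian _ \<longleftrightarrow> (\<forall>I::'a set. ideal I \<longrightarrow> (\<exists>S. finite S \<and> I = ideal_gen S))"

definition ideal_smult ::
    "('a::comm_ring_1 \<Rightarrow> 'b::ab_group_add \<Rightarrow> 'b) \<Rightarrow> 'a set \<Rightarrow> 'b set \<Rightarrow> 'b set"
  where "ideal_smult scale I A = module.span scale {scale r m | r m. r \<in> I \<and> m \<in> A}"

definition ideal_power :: "'a::comm_ring_1 set \<Rightarrow> nat \<Rightarrow> 'a set"
  where "ideal_power I n = (ideal_smult (*) I ^^ n) UNIV"

definition is_reduction :: "'a::comm_ring_1 set \<Rightarrow> 'a set \<Rightarrow> bool"
  where "is_reduction J I \<longleftrightarrow>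
    ideal J \<and> J \<subseteq> I \<and> (\<exists>m. ideal_smult (*) J (ideal_power I m) = ideal_power I (Suc m))"

definition is_subring :: "'a::comm_ring_1 set \<Rightarrow> bool"
  where "is_subring T \<longleftrightarrow>
    1 \<in> T \<and> (\<forall>a\<in>T. \<forall>b\<in>T. a - b \<in> T \<and> a * b \<in> T)"


section \<open>Gradings\<close>

definition decomposes :: "('i \<Rightarrow> 'b::ab_group_add set) \<Rightarrow> ('i \<Rightarrow> 'b) \<Rightarrow> 'b \<Rightarrow> bool"
  where "decomposes G f x \<longleftrightarrow>
    (\<forall>i. f i \<in> G i) \<and> finite {i. f i \<noteq> 0} \<and> x = (\<Sum>i | f i \<noteq> 0. f i)"

definition is_direct_sum :: "('i \<Rightarrow> 'b::ab_group_add set) \<Rightarrow> bool"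
  where "is_direct_sum G \<longleftrightarrow>
    (\<forall>i. 0 \<in> G i \<and> (\<forall>x\<in>G i. \<forall>y\<in>G i. x - y \<in> G i)) \<and> (\<forall>x. \<exists>!f. decomposes G f x)"

definition graded_ring :: "(nat \<Rightarrow> 'a::comm_ring_1 set) \<Rightarrow> bool"
  where "graded_ring Rg \<longleftrightarrow>
    is_direct_sum Rg \<and> 1 \<in> Rg 0 \<and>
    (\<forall>i j. \<forall>a\<in>Rg i. \<forall>b\<in>Rg j. a * b \<in> Rg (i + j))"

definition graded_module ::
    "(nat \<Rightarrow> 'a::comm_ring_1 set) \<Rightarrow> ('a \<Rightarrow> 'b::ab_group_add \<Rightarrow> 'b) \<Rightarrow> (int \<Rightarrow> 'b set) \<Rightarrow> bool"
  where "graded_module Rg scale Mg \<longleftrightarrow>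
    module scale \<and> is_direct_sum Mg \<and>
    (\<forall>i j. \<forall>a\<in>Rg i. \<forall>m\<in>Mg j. scale a m \<in> Mg (int i + j))"

text \<open>Closure under taking homogeneous components: together with being a submodule (an ideal)
  this is what makes a subset a graded submodule (a homogeneous ideal).\<close>

definition homogeneous_subset :: "('i \<Rightarrow> 'b::ab_group_add set) \<Rightarrow> 'b set \<Rightarrow> bool"
  where "homogeneous_subset G S \<longleftrightarrow> (\<forall>x\<in>S. \<forall>f. decomposes G f x \<longrightarrow> (\<forall>i. f i \<in> S))"


section \<open>Quotient modules\<close>

text \<open>Quotients such as \<open>I\<^sup>n M / I\<^sup>n N\<close> vary with \<open>n\<close>, so they cannot be types; they are
  structures with an explicit carrier consisting of cosets.\<close>

record ('r, 'l) rmodule =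
  mcarrier :: "'l set"
  madd :: "'l \<Rightarrow> 'l \<Rightarrow> 'l"
  mzero :: 'l
  mact :: "'r \<Rightarrow> 'l \<Rightarrow> 'l"

record ('r, 'l) gmodule = "('r, 'l) rmodule" +
  piece :: "int \<Rightarrow> 'l set"

definition coset :: "'b::ab_group_add set \<Rightarrow> 'b \<Rightarrow> 'b set"
  where "coset B x = (\<lambda>b. x + b) ` B"

text \<open>For \<open>X = x + B\<close> the action below yields \<open>r x + B\<close>.\<close>

definition quotient_module ::
    "('r \<Rightarrow> 'b::ab_group_add \<Rightarrow> 'b) \<Rightarrow> 'b set \<Rightarrow> 'b set \<Rightarrow> ('r, 'b set) rmodule"
  where "quotient_module scale A B =
    \<lparr> mcarrier = coset B ` A,
      madd = (\<lambda>X Y. {x + y | x y. x \<in> X \<and> y \<in> Y}),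
      mzero = B,
      mact = (\<lambda>r X. {scale r x + b | x b. x \<in> X \<and> b \<in> B}) \<rparr>"

definition graded_quotient ::
    "('r \<Rightarrow> 'b::ab_group_add \<Rightarrow> 'b) \<Rightarrow> (int \<Rightarrow> 'b set) \<Rightarrow> 'b set \<Rightarrow> 'b set \<Rightarrow> ('r, 'b set) gmodule"
  where "graded_quotient scale Mg A B =
    rmodule.extend (quotient_module scale A B)
      (gmodule.fields (\<lambda>u. coset B ` (A \<inter> Mg u)))"


section \<open>Associated primes, v-numbers and initial degree\<close>

definition elt_ann :: "('r, 'l, 'z) rmodule_scheme \<Rightarrow> 'l \<Rightarrow> 'r set"
  where "elt_ann L x = {r. mact L r x = mzero L}"

definition Ass :: "('r::comm_ring_1, 'l, 'z) rmodule_scheme \<Rightarrow> 'r set set"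
  where "Ass L = {\<pp>. prime_ideal \<pp> \<and> (\<exists>x\<in>mcarrier L. \<pp> = elt_ann L x)}"

text \<open>Values in the extended reals, so that infima of empty sets are \<open>\<infinity>\<close>.\<close>

definition v_number_at :: "'r set \<Rightarrow> ('r, 'l) gmodule \<Rightarrow> ereal"
  where "v_number_at \<pp> L =
    (INF u \<in> {u. \<exists>x\<in>piece L u. \<pp> = elt_ann L x}. ereal (of_int u))"

definition v_number :: "('r::comm_ring_1, 'l) gmodule \<Rightarrow> ereal"
  where "v_number L = (INF \<pp> \<in> Ass L. v_number_at \<pp> L)"

definition indeg :: "('r, 'l) gmodule \<Rightarrow> ereal"
  where "indeg L = (INF u \<in> {u. piece L u \<noteq> {mzero L}}. ereal (of_int u))"

definition eventually_linear :: "(nat \<Rightarrow> ereal) \<Rightarrow> int \<Rightarrow> bool"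
  where "eventually_linear f a \<longleftrightarrow>
    (\<exists>b::int. \<forall>\<^sub>F n in sequentially. f n = ereal (of_int (a * int n + b)))"


section \<open>Rees algebra and Rees modules\<close>

text \<open>The direct sum of the \<open>J\<^sup>n\<close> is realised inside the polynomial ring, the summand \<open>J\<^sup>n\<close>
  sitting in degree \<open>n\<close>; the direct sum of the \<open>I\<^sup>n A\<close> consists of finitely supported sequences.\<close>

definition rees_algebra :: "'a::comm_ring_1 set \<Rightarrow> 'a poly set"
  where "rees_algebra J = {p. \<forall>n. coeff p n \<in> ideal_power J n}"

definition rees_module ::
    "('a::comm_ring_1 \<Rightarrow> 'b::ab_group_add \<Rightarrow> 'b) \<Rightarrow> 'a set \<Rightarrow> 'b set \<Rightarrow> (nat \<Rightarrow>\<^sub>0 'b) set"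
  where "rees_module scale I A =
    {h. \<forall>n. Poly_Mapping.lookup h n \<in> ideal_smult scale (ideal_power I n) A}"

definition rees_scale ::
    "('a::comm_ring_1 \<Rightarrow> 'b::ab_group_add \<Rightarrow> 'b) \<Rightarrow> 'a poly \<Rightarrow> (nat \<Rightarrow>\<^sub>0 'b) \<Rightarrow> (nat \<Rightarrow>\<^sub>0 'b)"
  where "rees_scale scale p h =
    (\<Sum>i\<le>degree p. \<Sum>k\<in>Poly_Mapping.keys h.
       Poly_Mapping.single (i + k) (scale (coeff p i) (Poly_Mapping.lookup h k)))"

definition module_ann :: "'r set \<Rightarrow> ('r, 'l, 'z) rmodule_scheme \<Rightarrow> 'r set"
  where "module_ann S L = {r \<in> S. \<forall>x\<in>mcarrier L. mact L r x = mzero L}"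

definition radical_in :: "'r::comm_ring_1 set \<Rightarrow> 'r set \<Rightarrow> 'r set"
  where "radical_in S A = {r \<in> S. \<exists>k>0. r ^ k \<in> A}"

definition rees_quotient ::
    "('a::comm_ring_1 \<Rightarrow> 'b::ab_group_add \<Rightarrow> 'b) \<Rightarrow> 'a set \<Rightarrow> 'b set \<Rightarrow> ('a poly, (nat \<Rightarrow>\<^sub>0 'b) set) rmodule"
  where "rees_quotient scale I N =
    quotient_module (rees_scale scale) (rees_module scale I UNIV) (rees_module scale I N)"

text \<open>The indices \<open>j\<close> whose minimum is \<open>\<delta>\<close>. Here \<open>monom (y j) 1\<close> is \<open>y j\<close> in the summand
  \<open>J\<^sup>1\<close> of the Rees algebra.\<close>

definition non_nilpotent_indices ::
    "('a::comm_ring_1 \<Rightarrow> 'b::ab_group_add \<Rightarrow> 'b) \<Rightarrow> 'a set \<Rightarrow> 'b set \<Rightarrow> 'a set \<Rightarrow> (nat \<Rightarrow> 'a) \<Rightarrow> nat \<Rightarrow> nat set"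
  where "non_nilpotent_indices scale I N J y c =
    {j \<in> {1..c}. monom (y j) 1 \<notin>
       radical_in (rees_algebra J) (module_ann (rees_algebra J) (rees_quotient scale I N))}"


section \<open>The modules \<open>I\<^sup>n M / I\<^sup>n N\<close>\<close>

definition power_quotient ::
    "('a::comm_ring_1 \<Rightarrow> 'b::ab_group_add \<Rightarrow> 'b) \<Rightarrow> (int \<Rightarrow> 'b set) \<Rightarrow> 'a set \<Rightarrow> 'b set \<Rightarrow> nat \<Rightarrow> ('a, 'b set) gmodule"
  where "power_quotient scale Mg I N n =
    graded_quotient scale Mg
      (ideal_smult scale (ideal_power I n) UNIV) (ideal_smult scale (ideal_power I n) N)"

definition stable_Ass ::
    "('a::comm_ring_1 \<Rightarrow> 'b::ab_group_add \<Rightarrow> 'b) \<Rightarrow> (int \<Rightarrow> 'b set) \<Rightarrow> 'a set \<Rightarrow> 'b set \<Rightarrow> 'a set set"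
  where "stable_Ass scale Mg I N =
    (THE B. \<forall>\<^sub>F n in sequentially. Ass (power_quotient scale Mg I N n) = B)"

end

theory Submission
  imports Defs
begin

text \<open>Everything takes place in pairs \<open>B \<subseteq> A\<close> of families \<open>A n\<close>, \<open>B n\<close> of graded submodules of \<open>M\<close>
  stable under the \<open>y j : A n \<rightarrow> A (n + 1)\<close>; such a pair stands for the graded module
  \<open>\<Oplus>\<^sub>n A n / B n\<close> over \<open>R[Y\<^sub>1, \<dots>, Y\<^sub>c]\<close>. Since \<open>J\<close> is a reduction of \<open>I\<close>, the pair of \<open>I\<^sup>n M\<close> and
  \<open>I\<^sup>n N\<close> is generated in bounded degrees, hence Noetherian.

  For a finitely generated pair the initial degree is eventually linear: if \<open>G/B\<close> is the torsion of
  the operator \<open>y l\<close> of smallest degree, then \<open>y l\<close> is injective on \<open>A/G\<close>, whose initial degree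
  thus grows by exactly \<open>deg (y l)\<close>, while \<open>y l\<close> is nilpotent on \<open>G/B\<close>, so that \<open>G/B\<close> has a finite
  filtration whose quotients are generated by the remaining operators. The slope is the degree of
  the first operator that is not nilpotent.

  For a prime \<open>P\<close>, the v-number at \<open>P\<close> is the initial degree of \<open>(0 : P)\<close> modulo its elements
  killed by some homogeneous \<open>s \<notin> P\<close>, so it is eventually linear as well, and its slope is at
  least that of the initial degree. If \<open>y j\<close> is not nilpotent, it stays non-nilpotent in the
  module belonging to some \<open>P\<close>; for the first such \<open>j\<close> this makes the v-number as small as
  possible in slope.\<close>

section \<open>Noetherian modules\<close>

text \<open>The slope has to be part of the inductive statement. The degrees occurring in a pair and
  its non-nilpotent operators both form unions along a short exact sequence, so a claim tying the
  slope to the least non-nilpotent operator survives extensions. v-numbers become initial degrees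
  because the annihilator of a homogeneous element is homogeneous: if it contains \<open>P\<close>
  properly, it contains a homogeneous \<open>s \<notin> P\<close>. A nilpotent operator stays
  nilpotent on subquotients, which bounds the slopes of v-numbers from below. That the bound is
  attained is the delicate point: the prime is a maximal annihilator modulo the torsion of
  \<open>y j\<close>, where \<open>y j\<close> is injective, and it is pulled back to
  \<open>A/B\<close> at the price of multiplying by a high power of \<open>y j\<close>. Two
  finiteness facts must be uniform in \<open>n\<close>: one finite set contains the associated
  primes of all \<open>A n / B n\<close>, and one exponent kills all torsion. Both need the chain
  condition for whole families, not just for each \<open>A n\<close>.\<close>

lemma module_mult: "module ((*) :: 'a::comm_ring_1 \<Rightarrow> 'a \<Rightarrow> 'a)"
  by unfold_locales (simp_all add: algebra_simps)

text \<open>The chain condition instead of finite generation: in this form the property is used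
  throughout and carries over to families of submodules.\<close>

locale noetherian_module = module scale
  for scale :: "'a::comm_ring_1 \<Rightarrow> 'b::ab_group_add \<Rightarrow> 'b" (infixr "*s" 75) +
  assumes acc: "(\<And>n. subspace (C n)) \<Longrightarrow> incseq C \<Longrightarrow> \<exists>k. \<forall>n\<ge>k. C n = C k"

lemma (in module) subspace_incseq_Union:
  fixes C :: "nat \<Rightarrow> 'b set"
  assumes "\<And>n. subspace (C n)" and "incseq C"
  shows "subspace (\<Union>n. C n)"
proof (rule subspaceI)
  show "0 \<in> (\<Union>n. C n)"
    using assms(1) subspace_0 by blast
next
  fix x z assume "x \<in> (\<Union>n. C n)" "z \<in> (\<Union>n. C n)"
  then obtain i j where "x \<in> C i" "z \<in> C j"
    by blast
  then have "x \<in> C (max i j)" "z \<in> C (max i j)"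
    using \<open>incseq C\<close> by (meson incseqD max.cobounded1 max.cobounded2 subsetD)+
  then show "x + z \<in> (\<Union>n. C n)"
    using assms(1) subspace_add by blast
next
  fix r x assume "x \<in> (\<Union>n. C n)"
  then show "r *s x \<in> (\<Union>n. C n)"
    using assms(1) subspace_scale by blast
qed

lemma incseq_finite_subset:
  fixes C :: "nat \<Rightarrow> 'c set"
  assumes "incseq C" and "finite S" and "S \<subseteq> (\<Union>n. C n)"
  shows "\<exists>k. S \<subseteq> C k"
  using assms(2,3)
proof induction
  case (insert s S)
  then obtain k l where "S \<subseteq> C k" "s \<in> C l"
    by auto
  then have "insert s S \<subseteq> C (max k l)"
    using assms(1) by (meson incseqD insert_subsetI max.cobounded1 max.cobounded2 subset_trans subsetD)
  then show ?case ..
qed auto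

lemma noetherian_imp_noetherian_module:
  assumes "noetherian TYPE('a::comm_ring_1)"
  shows "noetherian_module ((*) :: 'a \<Rightarrow> 'a \<Rightarrow> 'a)"
proof -
  interpret R: module "(*) :: 'a \<Rightarrow> 'a \<Rightarrow> 'a"
    by (rule module_mult)
  show ?thesis
  proof
    fix C :: "nat \<Rightarrow> 'a set"
    assume C: "\<And>n. ideal (C n)" "incseq C"
    then have "ideal (\<Union>n. C n)"
      by (rule R.subspace_incseq_Union)
    then have "\<exists>S. finite S \<and> (\<Union>n. C n) = ideal_gen S"
      using assms by (simp add: noetherian_def)
    then obtain S where S: "finite S" "(\<Union>n. C n) = ideal_gen S"
      by blast
    have "S \<subseteq> (\<Union>n. C n)"
      unfolding S(2) by (rule R.span_superset)
    then obtain k where "S \<subseteq> C k"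
      using incseq_finite_subset[OF C(2) S(1)] by auto
    then have "(\<Union>n. C n) \<subseteq> C k"
      unfolding S(2) using C(1) by (rule R.span_minimal)
    moreover have "C k \<subseteq> C n" if "n \<ge> k" for n
      using C(2) that by (rule incseqD)
    ultimately have "\<forall>n\<ge>k. C n = C k"
      by blast
    then show "\<exists>k. \<forall>n\<ge>k. C n = C k" ..
  qed
qed

text \<open>Induction on the generators. A chain in the span of \<open>insert s S\<close> is
  governed by two others, the ideals of coefficients of \<open>s\<close> and the traces on
  \<open>span S\<close>; once both are constant, so is the given one.\<close>

lemma (in module) noetherian_moduleI:
  assumes ring: "noetherian TYPE('a)" and fin: "finite S" "span S = UNIV"
  shows "noetherian_module scale"
proof -
  interpret R: noetherian_module "(*) :: 'a \<Rightarrow> 'a \<Rightarrow> 'a"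
    by (rule noetherian_imp_noetherian_module[OF ring])
  have "\<exists>k. \<forall>n\<ge>k. C n = C k"
    if "\<And>n. subspace (C n)" "incseq C" "\<And>n. C n \<subseteq> span S" for C :: "nat \<Rightarrow> 'b set"
    using fin(1) that
  proof (induction S arbitrary: C rule: finite_induct)
    case empty
    then have "C n = {0}" for n
      using subspace_0 by fastforce
    then show ?case
      by blast
  next
    case (insert s S)
    define L where "L n = {r. \<exists>w\<in>span S. r *s s + w \<in> C n}" for n
    have "ideal (L n)" for n
    proof (rule R.subspaceI)
      show "0 \<in> L n"
        unfolding L_def using insert.prems(1)[of n] subspace_0 span_zero by force
    next
      fix r r' assume "r \<in> L n" "r' \<in> L n"
      then obtain w w' where "w \<in> span S" "w' \<in> span S" "r *s s + w \<in> C n" "r' *s s + w' \<in> C n"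
        unfolding L_def by blast
      moreover have "(r + r') *s s + (w + w') = (r *s s + w) + (r' *s s + w')"
        by (simp add: algebra_simps)
      ultimately show "r + r' \<in> L n"
        unfolding L_def using insert.prems(1) subspace_add span_add by (metis (mono_tags, lifting) mem_Collect_eq)
    next
      fix t r assume "r \<in> L n"
      then obtain w where "w \<in> span S" "r *s s + w \<in> C n"
        unfolding L_def by blast
      moreover have "(t * r) *s s + t *s w = t *s (r *s s + w)"
        by (simp add: scale_right_distrib)
      ultimately show "t * r \<in> L n"
        unfolding L_def using insert.prems(1) subspace_scale span_scale by (metis (mono_tags, lifting) mem_Collect_eq)
    qed
    moreover have "incseq L"
      using insert.prems(2) unfolding L_def incseq_def by blast
    ultimately obtain k where k: "\<forall>n\<ge>k. L n = L k"
      using R.acc by blast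
    have "subspace (C n \<inter> span S)" for n
      using insert.prems(1) by (simp add: subspace_inter)
    moreover have "incseq (\<lambda>n. C n \<inter> span S)"
      using insert.prems(2) unfolding incseq_def by blast
    ultimately obtain l where l: "\<forall>n\<ge>l. C n \<inter> span S = C l \<inter> span S"
      using insert.IH[of "\<lambda>n. C n \<inter> span S"] by blast
    \<comment> \<open>An element of \<open>C n\<close> is corrected by one of the earlier member
      with the same coefficient of \<open>s\<close>; the difference lies in \<open>span S\<close>,
      where the chain is already constant.\<close>
    have "C n \<subseteq> C (max k l)" if n: "n \<ge> max k l" for n
    proof
      fix z assume z: "z \<in> C n"
      then obtain r w where w: "w \<in> span S" "z = r *s s + w"
        using insert.prems(3)[of n] span_breakdown_eq[of z s S] by (metis add_diff_cancel_left' diff_add_cancel add.commute subsetD)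
      then have "r \<in> L n"
        using z unfolding L_def by blast
      then have "r \<in> L (max k l)"
        using k n by (metis max.bounded_iff max.cobounded1)
      then obtain w' where w': "w' \<in> span S" "r *s s + w' \<in> C (max k l)"
        unfolding L_def by blast
      then have "r *s s + w' \<in> C n"
        using insert.prems(2) n by (meson incseqD subsetD)
      then have "w - w' \<in> C n \<inter> span S"
        using z w w' insert.prems(1)[of n] subspace_diff[of "C n" z "r *s s + w'"] span_diff by auto
      then have "w - w' \<in> C (max k l)"
        using l n by (metis IntD1 max.bounded_iff max.cobounded2)
      then have "(r *s s + w') + (w - w') \<in> C (max k l)"
        using w' insert.prems(1) subspace_add by blast
      then show "z \<in> C (max k l)"
        using w by simp
    qed
    then have "\<forall>n\<ge>max k l. C n = C (max k l)"
      using insert.prems(2) by (meson incseqD subset_antisym)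
    then show ?case ..
  qed
  then show ?thesis
    using fin(2) by unfold_locales auto
qed

section \<open>Families of submodules with operators\<close>

context noetherian_module
begin

definition stable_family :: "'a set \<Rightarrow> (nat \<Rightarrow> 'b set) \<Rightarrow> bool"
  where "stable_family T C \<longleftrightarrow>
    (\<forall>n. subspace (C n)) \<and> (\<forall>n. \<forall>t\<in>T. \<forall>z\<in>C n. t *s z \<in> C (Suc n))"

text \<open>For a stable pair in a Noetherian module this is finite generation of the sum of all
  \<open>A n / B n\<close> over the polynomial ring: each single \<open>A n\<close> is finitely
  generated anyway, so only large \<open>n\<close> need a condition.\<close>

definition eventually_generated :: "'a set \<Rightarrow> (nat \<Rightarrow> 'b set) \<Rightarrow> (nat \<Rightarrow> 'b set) \<Rightarrow> bool"
  where "eventually_generated T A B \<longleftrightarrow>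
    (\<exists>m. \<forall>n\<ge>m. A (Suc n) \<subseteq> span (B (Suc n) \<union> {t *s z | t z. t \<in> T \<and> z \<in> A n}))"

lemma stable_familyD:
  assumes "stable_family T C"
  shows "subspace (C n)" and "t \<in> T \<Longrightarrow> z \<in> C n \<Longrightarrow> t *s z \<in> C (Suc n)"
  using assms unfolding stable_family_def by auto

lemma stable_family_power:
  assumes "stable_family T C" and "t \<in> T" and "z \<in> C n"
  shows "t ^ k *s z \<in> C (n + k)"
proof (induction k)
  case (Suc k)
  then have "t *s (t ^ k *s z) \<in> C (Suc (n + k))"
    by (rule stable_familyD(2)[OF assms(1,2)])
  then show ?case
    by simp
qed (use assms(3) in simp)

lemma stable_family_mono: "stable_family T C \<Longrightarrow> T' \<subseteq> T \<Longrightarrow> stable_family T' C"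
  unfolding stable_family_def by blast

text \<open>The ascending chain condition for the graded submodules between \<open>B\<close> and \<open>A\<close> of
  \<open>\<Oplus>\<^sub>n A n\<close> over the polynomial ring whose variables act as the elements of \<open>T\<close>.\<close>

definition acc_between :: "'a set \<Rightarrow> (nat \<Rightarrow> 'b set) \<Rightarrow> (nat \<Rightarrow> 'b set) \<Rightarrow> bool"
  where "acc_between T A B \<longleftrightarrow>
    (\<forall>D. (\<forall>k. stable_family T (D k) \<and> B \<le> D k \<and> D k \<le> A) \<longrightarrow> incseq D \<longrightarrow>
      (\<exists>K. \<forall>k\<ge>K. D k = D K))"

lemma acc_betweenD:
  assumes "acc_between T A B" and "\<And>k. stable_family T (D k)" and "\<And>k. B \<le> D k"
    and "\<And>k. D k \<le> A" and "incseq D"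
  shows "\<exists>K. \<forall>k\<ge>K. D k = D K"
  using assms unfolding acc_between_def by blast

end

lemma eventually_const_uniform:
  fixes f :: "nat \<Rightarrow> nat \<Rightarrow> 'c"
  assumes "\<And>n. \<exists>k. \<forall>j\<ge>k. f n j = f n k"
  shows "\<exists>k. \<forall>n<m. \<forall>j\<ge>k. f n j = f n k"
proof -
  obtain g where g: "\<And>n j. j \<ge> g n \<Longrightarrow> f n j = f n (g n)"
    using assms by metis
  have "\<forall>n<m. \<forall>j\<ge>Max (g ` {..<m}). f n j = f n (Max (g ` {..<m}))"
  proof (intro allI impI)
    fix n j assume "n < m" and j: "Max (g ` {..<m}) \<le> j"
    then have "g n \<le> Max (g ` {..<m})"
      by (simp add: Max_ge)
    then show "f n j = f n (Max (g ` {..<m}))"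
      using g[of n j] g[of n "Max (g ` {..<m})"] j by simp
  qed
  then show ?thesis ..
qed

context noetherian_module
begin

lemma stable_families_acc_upto:
  assumes "\<And>k. stable_family T (D k)" and "incseq D"
  shows "\<exists>K. \<forall>n<m. \<forall>k\<ge>K. D k n = D K n"
proof -
  have "\<exists>k. \<forall>j\<ge>k. D j n = D k n" for n
  proof (rule acc)
    show "subspace (D k n)" for k
      by (rule stable_familyD(1)[OF assms(1)])
    show "incseq (\<lambda>k. D k n)"
      using assms(2) by (simp add: incseq_def le_fun_def)
  qed
  then show ?thesis
    by (rule eventually_const_uniform)
qed

lemma eventually_generated_mono:
  assumes "eventually_generated T A B" and "B \<le> B'"
  shows "eventually_generated T A B'"
proof -
  have "span (B (Suc n) \<union> X) \<subseteq> span (B' (Suc n) \<union> X)" for n X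
    using assms(2) by (intro span_mono) (auto simp: le_fun_def)
  then show ?thesis
    using assms(1) unfolding eventually_generated_def by (meson subset_trans)
qed

text \<open>This is \<open>B + Y A\<close>, so that \<open>A\<close> modulo it is the cokernel of
  \<open>Y\<close> on \<open>A/B\<close>. The alternative \<open>w = 0\<close> covers degree 0,
  which nothing maps into.\<close>

definition adjoin_image :: "'a \<Rightarrow> (nat \<Rightarrow> 'b set) \<Rightarrow> (nat \<Rightarrow> 'b set) \<Rightarrow> nat \<Rightarrow> 'b set"
  where "adjoin_image Y A B n =
    {b + w | b w. b \<in> B n \<and> (w = 0 \<or> (\<exists>m a. n = Suc m \<and> a \<in> A m \<and> w = Y *s a))}"

lemma adjoin_image_0: "adjoin_image Y A B 0 = B 0"
  unfolding adjoin_image_def by auto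

lemma adjoin_image_Suc:
  assumes "\<And>n. subspace (A n)"
  shows "adjoin_image Y A B (Suc n) = {b + Y *s a | b a. b \<in> B (Suc n) \<and> a \<in> A n}"
proof -
  have "(w = 0 \<or> (\<exists>m a. Suc n = Suc m \<and> a \<in> A m \<and> w = Y *s a)) \<longleftrightarrow> (\<exists>a. a \<in> A n \<and> w = Y *s a)" for w
    using subspace_0[OF assms, of n] scale_zero_right[of Y] by auto
  then show ?thesis
    unfolding adjoin_image_def by (simp only:) blast
qed

lemma le_adjoin_image: "B \<le> adjoin_image Y A B"
  unfolding adjoin_image_def le_fun_def by force

lemma image_mem_adjoin_image:
  assumes "a \<in> A n" and "subspace (B (Suc n))"
  shows "Y *s a \<in> adjoin_image Y A B (Suc n)"
  unfolding adjoin_image_def using assms subspace_0 by force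

lemma stable_family_adjoin_image:
  assumes "stable_family T A" and "stable_family T B"
  shows "stable_family T (adjoin_image Y A B)"
proof -
  note A = stable_familyD[OF assms(1)] and B = stable_familyD[OF assms(2)]
  note Suc' = adjoin_image_Suc[where A = A, OF A(1)]
  have "subspace (adjoin_image Y A B n)" for n
  proof (cases n)
    case 0
    then show ?thesis
      using adjoin_image_0 B(1) by simp
  next
    case (Suc n')
    show ?thesis
      unfolding Suc Suc'
    proof (rule subspaceI)
      show "0 \<in> {b + Y *s a | b a. b \<in> B (Suc n') \<and> a \<in> A n'}"
        using subspace_0[OF A(1)] subspace_0[OF B(1)] by force
    next
      fix x z
      assume "x \<in> {b + Y *s a | b a. b \<in> B (Suc n') \<and> a \<in> A n'}"
        "z \<in> {b + Y *s a | b a. b \<in> B (Suc n') \<and> a \<in> A n'}"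
      then obtain b a b' a' where "x = b + Y *s a" "z = b' + Y *s a'" "b \<in> B (Suc n')" "b' \<in> B (Suc n')" "a \<in> A n'" "a' \<in> A n'"
        by blast
      moreover then have "x + z = (b + b') + Y *s (a + a')"
        by (simp add: algebra_simps scale_right_distrib)
      ultimately show "x + z \<in> {b + Y *s a | b a. b \<in> B (Suc n') \<and> a \<in> A n'}"
        using subspace_add[OF A(1)] subspace_add[OF B(1)] by blast
    next
      fix r x
      assume "x \<in> {b + Y *s a | b a. b \<in> B (Suc n') \<and> a \<in> A n'}"
      then obtain b a where "x = b + Y *s a" "b \<in> B (Suc n')" "a \<in> A n'"
        by blast
      moreover then have "r *s x = r *s b + Y *s (r *s a)"
        by (simp add: scale_right_distrib mult.commute)
      ultimately show "r *s x \<in> {b + Y *s a | b a. b \<in> B (Suc n') \<and> a \<in> A n'}"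
        using subspace_scale[OF A(1)] subspace_scale[OF B(1)] by blast
    qed
  qed
  moreover have "t *s z \<in> adjoin_image Y A B (Suc n)"
    if t: "t \<in> T" and z: "z \<in> adjoin_image Y A B n" for n t z
  proof -
    consider "z \<in> B n" | b m a where "n = Suc m" "z = b + Y *s a" "b \<in> B n" "a \<in> A m"
      using z unfolding adjoin_image_def by force
    then show ?thesis
    proof cases
      case 1
      then show ?thesis
        using t B(2) le_adjoin_image unfolding le_fun_def by blast
    next
      case 2
      have "t *s z = t *s b + Y *s (t *s a)"
        using 2 by (simp add: scale_right_distrib mult.commute)
      then show ?thesis
        unfolding Suc' using 2 t A(2) B(2) by blast
    qed
  qed
  ultimately show ?thesis
    unfolding stable_family_def by blast
qed

lemma adjoin_image_le:
  assumes "stable_family T A" and "B \<le> A" and "Y \<in> T"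
  shows "adjoin_image Y A B \<le> A"
proof (rule le_funI, rule subsetI)
  fix n z assume "z \<in> adjoin_image Y A B n"
  then obtain b w where "z = b + w" "b \<in> B n" "w = 0 \<or> (\<exists>m a. n = Suc m \<and> a \<in> A m \<and> w = Y *s a)"
    unfolding adjoin_image_def by blast
  moreover then have "b \<in> A n" "w \<in> A n"
    using assms(2,3) stable_familyD[OF assms(1)] subspace_0 unfolding le_fun_def by auto
  ultimately show "z \<in> A n"
    using stable_familyD(1)[OF assms(1)] subspace_add by blast
qed

lemma eventually_generated_adjoin_image:
  assumes "stable_family (insert Y T) A" and "stable_family (insert Y T) B"
    and "eventually_generated (insert Y T) A B"
  shows "eventually_generated T A (adjoin_image Y A B)"
proof -
  obtain m where m: "\<And>n. n \<ge> m \<Longrightarrow> A (Suc n) \<subseteq> span (B (Suc n) \<union> {t *s z | t z. t \<in> insert Y T \<and> z \<in> A n})"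
    using assms(3) unfolding eventually_generated_def by blast
  have "A (Suc n) \<subseteq> span (adjoin_image Y A B (Suc n) \<union> {t *s z | t z. t \<in> T \<and> z \<in> A n})" if "n \<ge> m" for n
  proof -
    have "B (Suc n) \<subseteq> adjoin_image Y A B (Suc n)"
      using le_adjoin_image by (simp add: le_fun_def)
    moreover have "Y *s z \<in> adjoin_image Y A B (Suc n)" if "z \<in> A n" for z
      using that stable_familyD(1)[OF assms(2)] by (rule image_mem_adjoin_image)
    ultimately have "B (Suc n) \<union> {t *s z | t z. t \<in> insert Y T \<and> z \<in> A n} \<subseteq>
      adjoin_image Y A B (Suc n) \<union> {t *s z | t z. t \<in> T \<and> z \<in> A n}"
      by blast
    then show ?thesis
      using m[OF that] span_mono by blast
  qed
  then show ?thesis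
    unfolding eventually_generated_def by blast
qed

text \<open>As in Hilbert's basis theorem: with \<open>Y\<close> the last variable, a family \<open>D\<close> in a chain is determined
  by its families \<open>C i\<close> of coefficients of \<open>Y ^ i\<close>, which live over the remaining variables and
  increase with \<open>i\<close>.\<close>

theorem acc_between_if_generated:
  assumes "finite T" and "stable_family T A" and "stable_family T B" and "B \<le> A"
    and "eventually_generated T A B"
  shows "acc_between T A B"
  using assms
proof (induction T arbitrary: B rule: finite_induct)
  case empty
  \<comment> \<open>Without operators, generation means that \<open>A\<close> and \<open>B\<close>
    agree in all large degrees; the chain condition is then about finitely many positions.\<close>
  have span_B: "span (B n \<union> {t *s z | t z. t \<in> {} \<and> z \<in> A m}) \<subseteq> B n" for n m
    by (rule span_minimal) (auto simp: stable_familyD(1)[OF empty.prems(2)])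
  then obtain m where m: "\<And>n. n \<ge> m \<Longrightarrow> A (Suc n) \<subseteq> B (Suc n)"
    using empty.prems(4) unfolding eventually_generated_def by (meson subset_trans)
  show ?case
    unfolding acc_between_def
  proof (intro allI impI)
    fix D assume D: "\<forall>k. stable_family {} (D k) \<and> B \<le> D k \<and> D k \<le> A" "incseq D"
    then obtain K where K: "\<forall>n<Suc m. \<forall>k\<ge>K. D k n = D K n"
      using stable_families_acc_upto by blast
    have "D k n = D K n" if "k \<ge> K" for k n
    proof (cases "n < Suc m")
      case False
      then obtain n' where "n = Suc n'" "n' \<ge> m"
        by (metis Suc_le_D Suc_le_mono not_less)
      then have "D j n = B n" for j
        using m D(1) unfolding le_fun_def by blast
      then show ?thesis
        by simp
    qed (use K that in blast)
    then show "\<exists>K. \<forall>k\<ge>K. D k = D K"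
      by blast
  qed
next
  case (insert Y T)
  define B' where "B' = adjoin_image Y A B"
  note A = stable_familyD[OF insert.prems(1)] and B = stable_familyD[OF insert.prems(2)]
  note B'_0 = adjoin_image_0[of Y A B, folded B'_def]
    and B'_Suc = adjoin_image_Suc[where A = A and Y = Y and B = B, OF A(1), folded B'_def]
  have st: "stable_family T A" "stable_family T B"
    using insert.prems stable_family_mono by blast+
  have stB': "stable_family T B'"
    unfolding B'_def using st by (rule stable_family_adjoin_image)
  note subB' = stable_familyD(1)[OF stB']
  have B'A: "z \<in> B' n \<Longrightarrow> z \<in> A n" for z n
    using adjoin_image_le[OF insert.prems(1) insert.prems(3), of Y]
    unfolding B'_def le_fun_def by blast
  have genB': "eventually_generated T A B'"
    unfolding B'_def using insert.prems(1,2,4) by (rule eventually_generated_adjoin_image)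
  have accB': "acc_between T A B'"
    using insert.IH[OF st(1) stB' _ genB'] B'A
    by (auto simp: le_fun_def)
  show ?case
    unfolding acc_between_def
  proof (intro allI impI)
    fix D assume D: "\<forall>k. stable_family (insert Y T) (D k) \<and> B \<le> D k \<and> D k \<le> A" and incD: "incseq D"
    have stD: "stable_family (insert Y T) (D k)" for k
      using D by blast
    note D_st = stable_familyD[OF stD]
    have BD: "z \<in> B n \<Longrightarrow> z \<in> D k n" for z n k
      using D unfolding le_fun_def by blast
    have DA: "z \<in> D k n \<Longrightarrow> z \<in> A n" for z n k
      using D unfolding le_fun_def by blast
    have D_mono: "z \<in> D k n \<Longrightarrow> k \<le> k' \<Longrightarrow> z \<in> D k' n" for z n k k'
      using incD unfolding incseq_def le_fun_def by blast
    \<comment> \<open>Adding \<open>B'\<close> places \<open>C i k\<close> between \<open>B'\<close>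
      and \<open>A\<close>, where the induction hypothesis applies. Nothing is lost, as
      \<open>Y ^ i\<close> maps \<open>B'\<close> into \<open>B\<close> plus multiples of
      \<open>Y ^ Suc i\<close>.\<close>
    define C where "C i k n = {v + w | v w. v \<in> A n \<and> Y ^ i *s v \<in> D k (n + i) \<and> w \<in> B' n}" for i k n
    have C_st: "stable_family T (C i k)" for i k
      unfolding stable_family_def
    proof (intro conjI allI ballI)
      show "subspace (C i k n)" for n
      proof (rule subspaceI)
        show "0 \<in> C i k n"
          unfolding C_def using subspace_0[OF A(1)] subspace_0[OF subB'] subspace_0[OF D_st(1)] by force
      next
        fix x z assume "x \<in> C i k n" "z \<in> C i k n"
        then obtain v w v' w' where x: "x = v + w" "v \<in> A n" "Y ^ i *s v \<in> D k (n + i)" "w \<in> B' n"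
          and z: "z = v' + w'" "v' \<in> A n" "Y ^ i *s v' \<in> D k (n + i)" "w' \<in> B' n"
          unfolding C_def by blast
        have "x + z = (v + v') + (w + w')"
          using x z by simp
        moreover have "v + v' \<in> A n" "w + w' \<in> B' n"
          using x z subspace_add[OF A(1)] subspace_add[OF subB'] by blast+
        moreover have "Y ^ i *s (v + v') \<in> D k (n + i)"
          using x z subspace_add[OF D_st(1)] by (simp add: scale_right_distrib)
        ultimately show "x + z \<in> C i k n"
          unfolding C_def by blast
      next
        fix r x assume "x \<in> C i k n"
        then obtain v w where x: "x = v + w" "v \<in> A n" "Y ^ i *s v \<in> D k (n + i)" "w \<in> B' n"
          unfolding C_def by blast
        have "r *s x = r *s v + r *s w"
          using x by (simp add: scale_right_distrib)
        moreover have "r *s v \<in> A n" "r *s w \<in> B' n"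
          using x subspace_scale[OF A(1)] subspace_scale[OF subB'] by blast+
        moreover have "Y ^ i *s (r *s v) \<in> D k (n + i)"
          using x subspace_scale[OF D_st(1)] by (metis scale_left_commute)
        ultimately show "r *s x \<in> C i k n"
          unfolding C_def by blast
      qed
    next
      fix n t x assume t: "t \<in> T" and "x \<in> C i k n"
      then obtain v w where x: "x = v + w" "v \<in> A n" "Y ^ i *s v \<in> D k (n + i)" "w \<in> B' n"
        unfolding C_def by blast
      have "t *s x = t *s v + t *s w"
        using x by (simp add: scale_right_distrib)
      moreover have "t *s v \<in> A (Suc n)" "t *s w \<in> B' (Suc n)"
        using x t A(2) stable_familyD(2)[OF stB'] by auto
      moreover have "Y ^ i *s (t *s v) \<in> D k (Suc n + i)"
        using D_st(2)[of t "Y ^ i *s v" k "n + i"] x t by (simp add: mult.commute)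
      ultimately show "t *s x \<in> C i k (Suc n)"
        unfolding C_def by blast
    qed
    have B'C: "B' \<le> C i k" for i k
      unfolding C_def le_fun_def using subspace_0[OF A(1)] subspace_0[OF D_st(1)] by force
    have CA: "C i k \<le> A" for i k
      unfolding C_def le_fun_def using B'A subspace_add[OF A(1)] by blast
    have C_mono: "C i k \<le> C i' k'" if "i \<le> i'" "k \<le> k'" for i i' k k'
    proof -
      have "C i k n \<subseteq> C i' k' n" for n
      proof
        fix x assume "x \<in> C i k n"
        then obtain v w where x: "x = v + w" "v \<in> A n" "Y ^ i *s v \<in> D k (n + i)" "w \<in> B' n"
          unfolding C_def by blast
        have "Y ^ (i' - i) *s (Y ^ i *s v) \<in> D k (n + i + (i' - i))"
          using stable_family_power[OF stD] x by blast
        then have "Y ^ i' *s v \<in> D k (n + i')"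
          using that by (simp flip: power_add)
        then have "Y ^ i' *s v \<in> D k' (n + i')"
          using D_mono that by blast
        then show "x \<in> C i' k' n"
          unfolding C_def using x by blast
      qed
      then show ?thesis
        by (simp add: le_funI)
    qed
    \<comment> \<open>The diagonal stops at \<open>K0\<close>; by monotonicity in both indices this
      fixes \<open>C i k\<close> for all \<open>i\<close> and \<open>k\<close> beyond
      \<open>K0\<close> at once and leaves only the finitely many rows
      \<open>i < K0\<close>.\<close>
    obtain K0 where K0: "\<And>k. k \<ge> K0 \<Longrightarrow> C k k = C K0 K0"
      using acc_betweenD[OF accB', of "\<lambda>k. C k k"] C_st B'C CA C_mono
      by (auto simp: incseq_def)
    have K0': "C i k = C K0 K0" if "i \<ge> K0" "k \<ge> K0" for i k
      using K0[of "max i k"] C_mono[of i "max i k" k "max i k"] C_mono[of K0 i K0 k] that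
      by (simp add: antisym max.coboundedI1)
    have "\<exists>K. \<forall>k\<ge>K. C i k = C i K" for i
      using acc_betweenD[OF accB', of "\<lambda>k. C i k"] C_st B'C CA C_mono
      by (auto simp: incseq_def)
    then have "\<exists>K. \<forall>i<K0. \<forall>k\<ge>K. C i k = C i K"
      by (rule eventually_const_uniform)
    then obtain K1 where K1: "\<forall>i<K0. \<forall>k\<ge>K1. C i k = C i K1" ..
    define K where "K = max K0 K1"
    have CK: "C i k = C i K" if "k \<ge> K" for i k
    proof (cases "i < K0")
      case True
      moreover have "k \<ge> K1" "K \<ge> K1"
        using that unfolding K_def by simp_all
      ultimately show ?thesis
        using K1 by metis
    next
      case False
      then show ?thesis
        using K0'[of i k] K0'[of i K] that unfolding K_def by simp
    qed
    have "D k n \<subseteq> D K n" if k: "k \<ge> K" for k n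
    proof
      fix z assume z: "z \<in> D k n"
      \<comment> \<open>Successive approximation: \<open>u \<in> D K n\<close> matches
        \<open>z\<close> up to a multiple of \<open>Y ^ i\<close>, and equality of the coefficient
        families pushes the error to the next power.\<close>
      have step: "\<exists>u\<in>D K n. z - u \<in> D K n \<or> (\<exists>w\<in>A (n - Suc i). Suc i \<le> n \<and> z - u = Y ^ Suc i *s w)"
        if "w \<in> A (n - i)" "i \<le> n" "u \<in> D K n" "z - u = Y ^ i *s w" for i w u
      proof -
        have "Y ^ i *s w \<in> D k (n - i + i)"
          using that(2,4) z D_mono[OF that(3) k] subspace_diff[OF D_st(1)[of k n]] by (metis le_add_diff_inverse2)
        then have "w \<in> C i k (n - i)"
          unfolding C_def using that(1) subspace_0[OF subB'] by force
        then obtain v w' where v: "w = v + w'" "v \<in> A (n - i)" "Y ^ i *s v \<in> D K (n - i + i)" "w' \<in> B' (n - i)"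
          unfolding CK[OF k] C_def by blast
        then have v': "Y ^ i *s v \<in> D K n"
          using that(2) by simp
        have eq: "z - (u + Y ^ i *s v) = Y ^ i *s w'"
          using that(4) v(1) by (simp add: scale_right_distrib algebra_simps)
        have uv: "u + Y ^ i *s v \<in> D K n"
          using that(3) v' subspace_add[OF D_st(1)] by blast
        show ?thesis
        proof (cases "n - i")
          case 0
          then have "w' \<in> B (n - i)"
            using v(4) B'_0 by simp
          then have "Y ^ i *s w' \<in> B (n - i + i)"
            by (intro stable_family_power[OF insert.prems(2)]) auto
          then show ?thesis
            using eq uv BD that(2) by (metis le_add_diff_inverse2)
        next
          case (Suc j)
          then obtain b a where b: "w' = b + Y *s a" "b \<in> B (n - i)" "a \<in> A j"
            using v(4) B'_Suc by auto
          have "Y ^ i *s b \<in> B (n - i + i)"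
            using b by (intro stable_family_power[OF insert.prems(2)]) auto
          then have "u + Y ^ i *s v + Y ^ i *s b \<in> D K n"
            using uv BD that(2) subspace_add[OF D_st(1)] by (metis le_add_diff_inverse2)
          moreover have "z - (u + Y ^ i *s v + Y ^ i *s b) = Y ^ Suc i *s a"
            using eq b(1) by (simp add: scale_right_distrib algebra_simps)
          moreover have "n - Suc i = j" "Suc i \<le> n"
            using Suc by simp_all
          ultimately show ?thesis
            using b(3) by blast
        qed
      qed
      have "\<exists>u\<in>D K n. z - u \<in> D K n \<or> (\<exists>w\<in>A (n - i). i \<le> n \<and> z - u = Y ^ i *s w)" for i
      proof (induction i)
        case 0
        show ?case
          using subspace_0[OF D_st(1)] DA[OF z] by (intro bexI[of _ 0]) auto
      next
        case (Suc i)
        then show ?case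
          using step by blast
      qed
      \<comment> \<open>An exponent \<open>n + 1\<close> does not fit into degree \<open>n\<close>,
        so the error itself lies in \<open>D K n\<close>.\<close>
      from this[of "Suc n"] obtain u where "u \<in> D K n" "z - u \<in> D K n"
        by auto
      then show "z \<in> D K n"
        using subspace_add[OF D_st(1)] by fastforce
    qed
    then have "\<forall>k\<ge>K. D k = D K"
      using D_mono by (metis ext subsetI subset_antisym)
    then show "\<exists>K. \<forall>k\<ge>K. D k = D K" ..
  qed
qed

text \<open>The subfamilies \<open>G k\<close> of \<open>D\<close> generated over \<open>B\<close>
  by the degrees up to \<open>k\<close> ascend. If they stop at \<open>K\<close>, then
  \<open>D\<close> needs no new generators above degree \<open>K\<close>.\<close>

lemma eventually_generated_if_acc:
  assumes acc: "acc_between T A B" and A: "stable_family T A" and B: "stable_family T B"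
    and D: "stable_family T D" and BD: "B \<le> D" and DA: "D \<le> A"
  shows "eventually_generated T D B"
proof -
  define G where "G k n = rec_nat (D 0)
    (\<lambda>n X. if Suc n \<le> k then D (Suc n) else span (B (Suc n) \<union> {t *s z | t z. t \<in> T \<and> z \<in> X})) n" for k n
  have G_0: "G k 0 = D 0"
    and G_Suc: "G k (Suc n) = (if Suc n \<le> k then D (Suc n) else span (B (Suc n) \<union> {t *s z | t z. t \<in> T \<and> z \<in> G k n}))" for k n
    unfolding G_def by simp_all
  have G_low: "G k n = D n" if "n \<le> k" for k n
    using that by (cases n) (simp_all add: G_0 G_Suc)
  have GD: "G k n \<subseteq> D n" for k n
  proof (induction n)
    case (Suc n)
    have "span (B (Suc n) \<union> {t *s z | t z. t \<in> T \<and> z \<in> G k n}) \<subseteq> D (Suc n)"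
      using Suc BD stable_familyD[OF D] by (intro span_minimal) (auto simp: le_fun_def)
    then show ?case
      by (simp add: G_Suc)
  qed (simp add: G_0)
  have "subspace (G k n)" for k n
    by (cases n) (simp_all add: G_0 G_Suc stable_familyD[OF D])
  moreover have "t *s z \<in> G k (Suc n)" if "t \<in> T" "z \<in> G k n" for t z k n
    using that GD[of k n] stable_familyD(2)[OF D] by (auto simp: G_Suc intro: span_base)
  ultimately have st: "stable_family T (G k)" for k
    unfolding stable_family_def by blast
  have "G k n \<subseteq> G (Suc k) n" for k n
  proof (induction n)
    case (Suc n)
    have "span (B (Suc n) \<union> {t *s z | t z. t \<in> T \<and> z \<in> G k n}) \<subseteq>
        span (B (Suc n) \<union> {t *s z | t z. t \<in> T \<and> z \<in> G (Suc k) n})"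
      using Suc by (intro span_mono) blast
    moreover have "span (B (Suc n) \<union> {t *s z | t z. t \<in> T \<and> z \<in> G k n}) \<subseteq> D (Suc n)"
      using GD[of k n] BD stable_familyD[OF D] by (intro span_minimal) (auto simp: le_fun_def)
    ultimately show ?case
      by (simp add: G_Suc)
  qed (simp add: G_0)
  then have inc: "incseq G"
    by (intro incseq_SucI le_funI)
  have "B n \<subseteq> G k n" for k n
    using BD by (cases n) (auto simp: le_fun_def G_0 G_Suc intro: span_base)
  moreover have "G k n \<subseteq> A n" for k n
    using GD DA unfolding le_fun_def by blast
  ultimately obtain K where K: "\<And>k. k \<ge> K \<Longrightarrow> G k = G K"
    using acc_betweenD[OF acc, of G] st inc by (auto simp: le_fun_def)
  have "D (Suc n) \<subseteq> span (B (Suc n) \<union> {t *s z | t z. t \<in> T \<and> z \<in> D n})" if "n \<ge> K" for n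
  proof -
    have "G K (Suc n) = span (B (Suc n) \<union> {t *s z | t z. t \<in> T \<and> z \<in> G K n})"
      using that by (simp add: G_Suc)
    \<comment> \<open>\<open>G (Suc n)\<close> and \<open>G n\<close> agree with \<open>D\<close> in
      degrees \<open>Suc n\<close> and \<open>n\<close> by construction, and both equal
      \<open>G K\<close>.\<close>
    moreover have "G K (Suc n) = D (Suc n)" "G K n = D n"
      using K[of "Suc n"] K[of n] G_low[of "Suc n" "Suc n"] G_low[of n n] that by simp_all
    ultimately show ?thesis
      by simp
  qed
  then show ?thesis
    unfolding eventually_generated_def by blast
qed

end

section \<open>Homogeneous components\<close>

definition component :: "('i \<Rightarrow> 'b::ab_group_add set) \<Rightarrow> 'b \<Rightarrow> 'i \<Rightarrow> 'b"
  where "component G x = (THE f. decomposes G f x)"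

lemma decomposesI:
  assumes "\<And>i. f i \<in> G i" and "finite S" and "\<And>i. i \<notin> S \<Longrightarrow> f i = 0" and "x = sum f S"
  shows "decomposes G f x"
proof -
  have "{i. f i \<noteq> 0} \<subseteq> S"
    using assms(3) by blast
  moreover then have "(\<Sum>i | f i \<noteq> 0. f i) = sum f S"
    using assms(2) by (intro sum.mono_neutral_left) auto
  ultimately show ?thesis
    using assms(1,2,4) finite_subset unfolding decomposes_def by auto
qed

context
  fixes G :: "'i \<Rightarrow> 'b::ab_group_add set"
  assumes G: "is_direct_sum G"
begin

lemma direct_sum_closed:
  shows "0 \<in> G i" and "x \<in> G i \<Longrightarrow> z \<in> G i \<Longrightarrow> x + z \<in> G i"
proof -
  have "0 \<in> G i" and diff: "a \<in> G i \<Longrightarrow> b \<in> G i \<Longrightarrow> a - b \<in> G i" for a b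
    using G unfolding is_direct_sum_def by auto
  then show "0 \<in> G i"
    by blast
  show "x + z \<in> G i" if "x \<in> G i" "z \<in> G i"
    using diff[OF that(1) diff[OF \<open>0 \<in> G i\<close> that(2)]] by simp
qed

lemma decomposes_component: "decomposes G (component G x) x"
  unfolding component_def
  by (rule theI'[OF spec[OF conjunct2[OF G[unfolded is_direct_sum_def]]]])

lemma component_eqI: "decomposes G f x \<Longrightarrow> component G x = f"
  unfolding component_def
  by (rule the1_equality[OF spec[OF conjunct2[OF G[unfolded is_direct_sum_def]]]])

lemma component_mem: "component G x i \<in> G i"
  and finite_component: "finite {i. component G x i \<noteq> 0}"
  and sum_component: "(\<Sum>i | component G x i \<noteq> 0. component G x i) = x"
  using decomposes_component[of x] unfolding decomposes_def by auto

lemma sum_component_superset: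
  assumes "finite S" and "{i. component G x i \<noteq> 0} \<subseteq> S"
  shows "x = sum (component G x) S"
proof -
  have "sum (component G x) S = (\<Sum>i | component G x i \<noteq> 0. component G x i)"
    using assms by (intro sum.mono_neutral_right) auto
  then show ?thesis
    by (simp add: sum_component)
qed

lemma component_homogeneous:
  assumes "x \<in> G i"
  shows "component G x = (\<lambda>j. if j = i then x else 0)"
  using assms direct_sum_closed(1) by (intro component_eqI decomposesI[where S = "{i}"]) auto

lemma component_zero: "component G 0 i = 0"
  using component_homogeneous[OF direct_sum_closed(1)] by simp

lemma component_add: "component G (x + z) i = component G x i + component G z i"
proof -
  let ?S = "{i. component G x i \<noteq> 0} \<union> {i. component G z i \<noteq> 0}"
  have S: "finite ?S"
    using finite_component by blast
  have "decomposes G (\<lambda>i. component G x i + component G z i) (x + z)"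
  proof (rule decomposesI[OF _ S])
    show "x + z = (\<Sum>i\<in>?S. component G x i + component G z i)"
      using sum_component_superset[OF S, of x] sum_component_superset[OF S, of z]
      by (simp add: sum.distrib)
  qed (use component_mem direct_sum_closed in auto)
  then show ?thesis
    by (simp add: component_eqI)
qed

lemma component_sum: "component G (sum f S) i = (\<Sum>s\<in>S. component G (f s) i)"
  by (induction S rule: infinite_finite_induct) (simp_all add: component_zero component_add)

lemma homogeneous_subset_iff: "homogeneous_subset G S \<longleftrightarrow> (\<forall>x\<in>S. \<forall>i. component G x i \<in> S)"
  unfolding homogeneous_subset_def using decomposes_component component_eqI by blast

end

section \<open>Graded modules and homogeneous families\<close>

locale graded_noetherian_module = noetherian_module scale
  for scale :: "'a::comm_ring_1 \<Rightarrow> 'b::ab_group_add \<Rightarrow> 'b" (infixr "*s" 75) +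
  fixes Rg :: "nat \<Rightarrow> 'a set" and Mg :: "int \<Rightarrow> 'b set"
  assumes noetherian_ring: "noetherian TYPE('a)"
    and graded_R: "graded_ring Rg"
    and graded_M: "graded_module Rg scale Mg"
    and fin_gen: "\<exists>S. finite S \<and> span S = UNIV"
begin

lemma direct_sum_R: "is_direct_sum Rg" and direct_sum_M: "is_direct_sum Mg"
  using graded_R graded_M unfolding graded_ring_def graded_module_def by auto

abbreviation rcomp :: "'a \<Rightarrow> nat \<Rightarrow> 'a" where "rcomp \<equiv> component Rg"
abbreviation mcomp :: "'b \<Rightarrow> int \<Rightarrow> 'b" where "mcomp \<equiv> component Mg"

lemmas rcomp_mem = component_mem[OF direct_sum_R]
  and mcomp_mem = component_mem[OF direct_sum_M]
  and mcomp_zero = component_zero[OF direct_sum_M]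
  and mcomp_add = component_add[OF direct_sum_M]
  and mcomp_homogeneous = component_homogeneous[OF direct_sum_M]
  and finite_rcomp = finite_component[OF direct_sum_R]
  and finite_mcomp = finite_component[OF direct_sum_M]

lemma scale_mem_piece: "r \<in> Rg i \<Longrightarrow> z \<in> Mg u \<Longrightarrow> r *s z \<in> Mg (int i + u)"
  using graded_M unfolding graded_module_def by blast

lemma mcomp_self: "z \<in> Mg u \<Longrightarrow> mcomp z u = z"
  by (simp add: mcomp_homogeneous)

lemma mem_if_rcomp:
  assumes "ideal P" and "\<And>i. rcomp r i \<in> P"
  shows "r \<in> P"
proof -
  have "(\<Sum>i | rcomp r i \<noteq> 0. rcomp r i) \<in> P"
    using assms by (intro module.subspace_sum[OF module_mult]) auto
  then show ?thesis
    by (simp add: sum_component[OF direct_sum_R])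
qed

lemma mem_if_mcomp:
  assumes "subspace S" and "\<And>u. mcomp z u \<in> S"
  shows "z \<in> S"
proof -
  have "(\<Sum>u | mcomp z u \<noteq> 0. mcomp z u) \<in> S"
    using assms by (intro subspace_sum) auto
  then show ?thesis
    by (simp add: sum_component[OF direct_sum_M])
qed

lemma mcomp_scale_homogeneous:
  assumes "r \<in> Rg i"
  shows "mcomp (r *s z) u = r *s mcomp z (u - int i)"
proof -
  let ?S = "(\<lambda>v. v + int i) ` {v. mcomp z v \<noteq> 0}"
  have "decomposes Mg (\<lambda>u. r *s mcomp z (u - int i)) (r *s z)"
  proof (rule decomposesI)
    show "r *s mcomp z (u - int i) \<in> Mg u" for u
      using scale_mem_piece[OF assms mcomp_mem[of z "u - int i"]] by simp
    show "finite ?S"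
      by (simp add: finite_mcomp)
    show "r *s mcomp z (u - int i) = 0" if "u \<notin> ?S" for u
    proof -
      have "mcomp z (u - int i) = 0"
        using that by (force simp: image_iff)
      then show ?thesis
        by simp
    qed
    have "r *s z = r *s (\<Sum>v | mcomp z v \<noteq> 0. mcomp z v)"
      by (simp add: sum_component[OF direct_sum_M])
    also have "\<dots> = (\<Sum>u\<in>?S. r *s mcomp z (u - int i))"
      by (simp add: sum.reindex scale_sum_right inj_on_def)
    finally show "r *s z = (\<Sum>u\<in>?S. r *s mcomp z (u - int i))" .
  qed
  then show ?thesis
    by (simp add: component_eqI[OF direct_sum_M])
qed

lemma mcomp_scale: "mcomp (r *s z) u = (\<Sum>i | rcomp r i \<noteq> 0. rcomp r i *s mcomp z (u - int i))"
proof -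
  have "r *s z = (\<Sum>i | rcomp r i \<noteq> 0. rcomp r i) *s z"
    by (simp add: sum_component[OF direct_sum_R])
  also have "\<dots> = (\<Sum>i | rcomp r i \<noteq> 0. rcomp r i *s z)"
    by (rule scale_sum_left)
  finally show ?thesis
    by (simp add: component_sum[OF direct_sum_M] mcomp_scale_homogeneous[OF rcomp_mem])
qed

definition homogeneous_family :: "(nat \<Rightarrow> 'b set) \<Rightarrow> bool"
  where "homogeneous_family C \<longleftrightarrow> (\<forall>n. homogeneous_subset Mg (C n))"

lemma homogeneous_family_iff: "homogeneous_family C \<longleftrightarrow> (\<forall>n. \<forall>z\<in>C n. \<forall>u. mcomp z u \<in> C n)"
  unfolding homogeneous_family_def by (simp add: homogeneous_subset_iff[OF direct_sum_M])

lemma homogeneous_familyD: "homogeneous_family C \<Longrightarrow> z \<in> C n \<Longrightarrow> mcomp z u \<in> C n"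
  unfolding homogeneous_family_iff by blast

text \<open>The ring has no negative degrees, so components of degree at most \<open>u\<close> of a
  multiple of \<open>z\<close> only involve components of \<open>z\<close> of degree at most
  \<open>u\<close>. Such submodules allow degree bounds to be checked on generators.\<close>

lemma subspace_mcomp_le:
  assumes "subspace S"
  shows "subspace {z. \<forall>v\<le>u. mcomp z v \<in> S}"
proof (rule subspaceI)
  show "0 \<in> {z. \<forall>v\<le>u. mcomp z v \<in> S}"
    by (simp add: mcomp_zero subspace_0[OF assms])
next
  fix x z assume "x \<in> {z. \<forall>v\<le>u. mcomp z v \<in> S}" "z \<in> {z. \<forall>v\<le>u. mcomp z v \<in> S}"
  then show "x + z \<in> {z. \<forall>v\<le>u. mcomp z v \<in> S}"
    by (simp add: mcomp_add subspace_add[OF assms])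
next
  fix r z assume "z \<in> {z. \<forall>v\<le>u. mcomp z v \<in> S}"
  then show "r *s z \<in> {z. \<forall>v\<le>u. mcomp z v \<in> S}"
    by (auto simp: mcomp_scale intro!: subspace_sum subspace_scale assms)
qed

lemma bounded_below: "\<exists>u0. \<forall>u<u0. Mg u \<subseteq> {0}"
proof -
  obtain S where S: "finite S" "span S = UNIV"
    using fin_gen by blast
  \<comment> \<open>The extra \<open>0\<close> keeps \<open>U\<close> nonempty, so that
    \<open>Min U\<close> makes sense.\<close>
  define U where "U = insert 0 (\<Union>s\<in>S. {u. mcomp s u \<noteq> 0})"
  have U: "finite U" "U \<noteq> {}"
    unfolding U_def using S(1) finite_mcomp by auto
  define V where "V = {z. \<forall>v\<le>Min U - 1. mcomp z v \<in> {0}}"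
  have "S \<subseteq> V"
  proof
    fix s assume "s \<in> S"
    then have "mcomp s v = 0" if "v \<le> Min U - 1" for v
      using Min_le[OF U(1), of v] that unfolding U_def by fastforce
    then show "s \<in> V"
      unfolding V_def by simp
  qed
  then have "span S \<subseteq> V"
    unfolding V_def by (intro span_minimal subspace_mcomp_le subspace_single_0)
  have "z = 0" if "u < Min U" "z \<in> Mg u" for u z
  proof -
    have "z \<in> V"
      using \<open>span S \<subseteq> V\<close> S(2) by blast
    then have "mcomp z u = 0"
      using that(1) unfolding V_def by simp
    then show ?thesis
      using mcomp_self[OF that(2)] by simp
  qed
  then show ?thesis
    by blast
qed

end

section \<open>Lowest degrees\<close>

text \<open>The minimum is attained, so \<open>S n\<close> is eventually nonempty. Sets of integers
  are kept until the end and only then turned into infima of extended reals.\<close>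

definition least_linear :: "(nat \<Rightarrow> int set) \<Rightarrow> int \<Rightarrow> bool"
  where "least_linear S a \<longleftrightarrow>
    (\<exists>b. \<forall>\<^sub>F n in sequentially. a * int n + b \<in> S n \<and> (\<forall>u\<in>S n. a * int n + b \<le> u))"

lemma least_linear_cong:
  assumes "\<forall>\<^sub>F n in sequentially. S n = S' n"
  shows "least_linear S a \<longleftrightarrow> least_linear S' a"
proof -
  have "least_linear S' a" if S: "least_linear S a" "\<forall>\<^sub>F n in sequentially. S n = S' n" for S S'
  proof -
    obtain b where "\<forall>\<^sub>F n in sequentially. a * int n + b \<in> S n \<and> (\<forall>u\<in>S n. a * int n + b \<le> u)"
      using S(1) unfolding least_linear_def by blast
    then have "\<forall>\<^sub>F n in sequentially. a * int n + b \<in> S' n \<and> (\<forall>u\<in>S' n. a * int n + b \<le> u)"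
      using S(2) by eventually_elim simp
    then show ?thesis
      unfolding least_linear_def by blast
  qed
  then show ?thesis
    using assms by (metis (mono_tags, lifting) eventually_mono)
qed

lemma least_linear_Un:
  assumes "least_linear S a" and "least_linear S' a'" and "a \<le> a'"
  shows "least_linear (\<lambda>n. S n \<union> S' n) a"
proof -
  obtain b where b: "\<forall>\<^sub>F n in sequentially. a * int n + b \<in> S n \<and> (\<forall>u\<in>S n. a * int n + b \<le> u)"
    using assms(1) unfolding least_linear_def by blast
  obtain b' where b': "\<forall>\<^sub>F n in sequentially. a' * int n + b' \<in> S' n \<and> (\<forall>u\<in>S' n. a' * int n + b' \<le> u)"
    using assms(2) unfolding least_linear_def by blast
  consider "a = a'" | "a < a'"
    using assms(3) by linarith
  then show ?thesis
  proof cases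
    case 1
    from b b' have "\<forall>\<^sub>F n in sequentially. a * int n + min b b' \<in> S n \<union> S' n \<and> (\<forall>u\<in>S n \<union> S' n. a * int n + min b b' \<le> u)"
    proof eventually_elim
      case (elim n)
      then show ?case
        using 1 by (force simp: min_def)
    qed
    then show ?thesis
      unfolding least_linear_def by blast
  next
    case 2
    \<comment> \<open>The slopes differ by at least 1, so from \<open>b - b'\<close> on the line of
      smaller slope is not above the other.\<close>
    have "\<forall>\<^sub>F n in sequentially. n \<ge> nat (b - b')"
      by (rule eventually_ge_at_top)
    with b b' have "\<forall>\<^sub>F n in sequentially. a * int n + b \<in> S n \<union> S' n \<and> (\<forall>u\<in>S n \<union> S' n. a * int n + b \<le> u)"
    proof eventually_elim
      case (elim n)
      have "(a + 1) * int n \<le> a' * int n"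
        using 2 by (intro mult_right_mono) auto
      then have "a * int n + b \<le> a' * int n + b'"
        using elim(3) by (simp add: algebra_simps)
      then show ?case
        using elim(1,2) by force
    qed
    then show ?thesis
      unfolding least_linear_def by blast
  qed
qed

text \<open>Meant for the v-number as a minimum over finitely many primes: a member of least slope
  decides, and the others can at most lower the constant term.\<close>

lemma least_linear_UN:
  assumes "finite P" and "p \<in> P" and "least_linear (S p) a"
    and "\<And>q. q \<in> P \<Longrightarrow> \<exists>a'\<ge>a. least_linear (S q) a'"
  shows "least_linear (\<lambda>n. \<Union>q\<in>P. S q n) a"
proof -
  have "least_linear (\<lambda>n. S p n \<union> (\<Union>q\<in>Q. S q n)) a" if "Q \<subseteq> P" "finite Q" for Q
    using that(2,1)
  proof induction
    case empty
    then show ?case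
      using assms(3) by simp
  next
    case (insert q Q)
    obtain a' where a': "a \<le> a'" "least_linear (S q) a'"
      using assms(4) insert.prems by blast
    have "least_linear (\<lambda>n. S p n \<union> (\<Union>q\<in>Q. S q n)) a"
      using insert by blast
    then have "least_linear (\<lambda>n. (S p n \<union> (\<Union>q\<in>Q. S q n)) \<union> S q n) a"
      using a'(2,1) by (rule least_linear_Un)
    moreover have "(S p n \<union> (\<Union>r\<in>Q. S r n)) \<union> S q n = S p n \<union> (\<Union>r\<in>insert q Q. S r n)" for n
      by blast
    ultimately show ?case
      by simp
  qed
  from this[of P] have "least_linear (\<lambda>n. S p n \<union> (\<Union>q\<in>P. S q n)) a"
    using assms(1) by simp
  moreover have "S p n \<union> (\<Union>q\<in>P. S q n) = (\<Union>q\<in>P. S q n)" for n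
    using assms(2) by blast
  ultimately show ?thesis
    by simp
qed

lemma least_linear_nonempty: "least_linear S a \<Longrightarrow> \<forall>\<^sub>F n in sequentially. S n \<noteq> {}"
  unfolding least_linear_def by (auto elim: eventually_mono)

lemma int_set_has_least:
  fixes S :: "int set"
  assumes "S \<noteq> {}" and "\<And>u. u \<in> S \<Longrightarrow> u0 \<le> u"
  shows "\<exists>m\<in>S. \<forall>u\<in>S. m \<le> u"
proof -
  obtain s where "s \<in> S" "\<And>u. u \<in> S \<Longrightarrow> nat (s - u0) \<le> nat (u - u0)"
    using assms(1) ex_has_least_nat[of "\<lambda>u. u \<in> S" _ "\<lambda>u. nat (u - u0)"] by blast
  moreover then have "s \<le> u" if "u \<in> S" for u
    using assms(2) that by (metis diff_mono diff_right_mono eq_iff_diff_eq_0 le_diff_eq nat_le_eq_zle diff_ge_0_iff_ge diff_add_cancel add_le_cancel_right)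
  ultimately show ?thesis
    by blast
qed

section \<open>Initial degrees under homogeneous operators\<close>

locale graded_operators = graded_noetherian_module scale Rg Mg
  for scale :: "'a::comm_ring_1 \<Rightarrow> 'b::ab_group_add \<Rightarrow> 'b" (infixr "*s" 75)
    and Rg :: "nat \<Rightarrow> 'a set" and Mg :: "int \<Rightarrow> 'b set" +
  fixes y :: "nat \<Rightarrow> 'a" and dg :: "nat \<Rightarrow> nat" and c :: nat
  assumes y_mem: "j \<in> {1..c} \<Longrightarrow> y j \<in> Rg (dg j)"
    and dg_mono: "mono_on {1..c} dg"
begin

text \<open>For graded families these are the degrees in which \<open>A n / B n\<close> is nonzero,
  so their minimum is the initial degree.\<close>

definition degrees :: "(nat \<Rightarrow> 'b set) \<Rightarrow> (nat \<Rightarrow> 'b set) \<Rightarrow> nat \<Rightarrow> int set"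
  where "degrees A B n = {u. \<not> A n \<inter> Mg u \<subseteq> B n}"

text \<open>One exponent serves all \<open>n\<close> and \<open>z\<close>, as for membership in the
  radical of an annihilator; an exponent depending on \<open>z\<close> would only express
  torsion.\<close>

definition nilpotent_on :: "nat \<Rightarrow> (nat \<Rightarrow> 'b set) \<Rightarrow> (nat \<Rightarrow> 'b set) \<Rightarrow> bool"
  where "nilpotent_on j A B \<longleftrightarrow> (\<exists>k. \<forall>n. \<forall>z\<in>A n. y j ^ k *s z \<in> B (n + k))"

definition non_nilpotent :: "nat \<Rightarrow> (nat \<Rightarrow> 'b set) \<Rightarrow> (nat \<Rightarrow> 'b set) \<Rightarrow> nat set"
  where "non_nilpotent l A B = {j \<in> {l..c}. \<not> nilpotent_on j A B}"

definition graded_family :: "(nat \<Rightarrow> 'b set) \<Rightarrow> bool"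
  where "graded_family C \<longleftrightarrow> stable_family (y ` {1..c}) C \<and> homogeneous_family C"

text \<open>The statement carried through the induction. The first implication ensures that a layer
  of a filtration without non-nilpotent operators does not influence the slope.\<close>

definition linear_indeg :: "nat \<Rightarrow> (nat \<Rightarrow> 'b set) \<Rightarrow> (nat \<Rightarrow> 'b set) \<Rightarrow> bool"
  where "linear_indeg l A B \<longleftrightarrow>
    (non_nilpotent l A B = {} \<longrightarrow> (\<forall>\<^sub>F n in sequentially. degrees A B n = {})) \<and>
    (non_nilpotent l A B \<noteq> {} \<longrightarrow> least_linear (degrees A B) (int (dg (Min (non_nilpotent l A B)))))"

lemma graded_familyD:
  assumes "graded_family C"
  shows "subspace (C n)" and "j \<in> {1..c} \<Longrightarrow> z \<in> C n \<Longrightarrow> y j *s z \<in> C (Suc n)"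
    and "j \<in> {1..c} \<Longrightarrow> z \<in> C n \<Longrightarrow> y j ^ k *s z \<in> C (n + k)"
    and "z \<in> C n \<Longrightarrow> mcomp z u \<in> C n"
    and "1 \<le> l \<Longrightarrow> stable_family (y ` {l..c}) C"
proof -
  have st: "stable_family (y ` {1..c}) C" and hom: "homogeneous_family C"
    using assms unfolding graded_family_def by auto
  show "subspace (C n)" and "j \<in> {1..c} \<Longrightarrow> z \<in> C n \<Longrightarrow> y j *s z \<in> C (Suc n)"
    using stable_familyD[OF st] by auto
  show "j \<in> {1..c} \<Longrightarrow> z \<in> C n \<Longrightarrow> y j ^ k *s z \<in> C (n + k)"
    using stable_family_power[OF st] by simp
  show "z \<in> C n \<Longrightarrow> mcomp z u \<in> C n"
    using homogeneous_familyD[OF hom] .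
  show "1 \<le> l \<Longrightarrow> stable_family (y ` {l..c}) C"
    by (rule stable_family_mono[OF st]) auto
qed

lemma graded_familyI:
  assumes "\<And>n. subspace (C n)" and "\<And>j n z. j \<in> {1..c} \<Longrightarrow> z \<in> C n \<Longrightarrow> y j *s z \<in> C (Suc n)"
    and "\<And>n z u. z \<in> C n \<Longrightarrow> mcomp z u \<in> C n"
  shows "graded_family C"
  unfolding graded_family_def stable_family_def homogeneous_family_iff using assms by auto

lemma mcomp_y: "j \<in> {1..c} \<Longrightarrow> mcomp (y j *s z) u = y j *s mcomp z (u - int (dg j))"
  using mcomp_scale_homogeneous y_mem by blast

lemma y_power_mem: "j \<in> {1..c} \<Longrightarrow> y j ^ k \<in> Rg (k * dg j)"
proof (induction k)
  case 0
  then show ?case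
    using graded_R unfolding graded_ring_def by simp
next
  case (Suc k)
  then show ?case
    using graded_R y_mem[of j] unfolding graded_ring_def by simp
qed

lemma mcomp_y_power: "j \<in> {1..c} \<Longrightarrow> mcomp (y j ^ k *s z) u = y j ^ k *s mcomp z (u - int (k * dg j))"
  using mcomp_scale_homogeneous y_power_mem by blast

lemma degrees_Un: "C \<le> B \<Longrightarrow> B \<le> A \<Longrightarrow> degrees A C n = degrees A B n \<union> degrees B C n"
  unfolding degrees_def le_fun_def by blast

lemma degrees_empty_iff:
  assumes "graded_family A" and "graded_family B"
  shows "degrees A B n = {} \<longleftrightarrow> A n \<subseteq> B n"
proof
  assume empty: "degrees A B n = {}"
  show "A n \<subseteq> B n"
  proof
    fix z assume "z \<in> A n"
    then have "mcomp z u \<in> A n \<inter> Mg u" for u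
      using graded_familyD(4)[OF assms(1)] mcomp_mem by blast
    then have "mcomp z u \<in> B n" for u
      using empty unfolding degrees_def by blast
    then show "z \<in> B n"
      using mem_if_mcomp[OF graded_familyD(1)[OF assms(2)]] by simp
  qed
qed (auto simp: degrees_def)

lemma nilpotent_on_mono:
  assumes "nilpotent_on j A B" and "A' \<le> A" and "B \<le> B'"
  shows "nilpotent_on j A' B'"
  using assms unfolding nilpotent_on_def le_fun_def by (meson subsetD)

lemma nilpotent_on_trans:
  assumes "nilpotent_on j A B" and "nilpotent_on j B C"
  shows "nilpotent_on j A C"
proof -
  obtain k where k: "\<And>n z. z \<in> A n \<Longrightarrow> y j ^ k *s z \<in> B (n + k)"
    using assms(1) unfolding nilpotent_on_def by blast
  obtain k' where k': "\<And>n z. z \<in> B n \<Longrightarrow> y j ^ k' *s z \<in> C (n + k')"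
    using assms(2) unfolding nilpotent_on_def by blast
  have "y j ^ (k' + k) *s z \<in> C (n + (k' + k))" if "z \<in> A n" for n z
    using k'[OF k[OF that]] by (simp add: power_add add.assoc add.commute[of k k'])
  then show ?thesis
    unfolding nilpotent_on_def by blast
qed

lemma non_nilpotent_Un:
  assumes "C \<le> B" and "B \<le> A"
  shows "non_nilpotent l A C = non_nilpotent l A B \<union> non_nilpotent l B C"
proof -
  have "nilpotent_on j A C \<longleftrightarrow> nilpotent_on j A B \<and> nilpotent_on j B C" for j
    using nilpotent_on_trans nilpotent_on_mono[OF _ order_refl assms(1)]
      nilpotent_on_mono[OF _ assms(2) order_refl] by blast
  then show ?thesis
    unfolding non_nilpotent_def by blast
qed

lemma finite_non_nilpotent: "finite (non_nilpotent l A B)"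
  and non_nilpotent_subset: "non_nilpotent l A B \<subseteq> {l..c}"
  unfolding non_nilpotent_def by auto

lemma dg_le: "i \<in> {1..c} \<Longrightarrow> j \<in> {1..c} \<Longrightarrow> i \<le> j \<Longrightarrow> dg i \<le> dg j"
  using dg_mono unfolding mono_on_def by blast

text \<open>Degrees and non-nilpotent operators both form unions along
  \<open>C \<le> B \<le> A\<close>, so the smaller slope wins; as \<open>dg\<close> is monotone, it
  belongs to the smaller index.\<close>

lemma linear_indeg_trans:
  assumes le: "C \<le> B" "B \<le> A" and AB: "linear_indeg l A B" and BC: "linear_indeg l B C"
    and l: "1 \<le> l"
  shows "linear_indeg l A C"
proof -
  note N = non_nilpotent_Un[OF le, of l]
  note dU = degrees_Un[OF le]
  let ?N1 = "non_nilpotent l A B" and ?N2 = "non_nilpotent l B C"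
  have in_range: "Min X \<in> {1..c}" if "X \<noteq> {}" "X \<subseteq> {l..c}" for X
    using that Min_in[of X] finite_subset[OF that(2)] l by fastforce
  consider "?N1 = {}" "?N2 = {}" | "?N1 = {}" "?N2 \<noteq> {}" | "?N1 \<noteq> {}" "?N2 = {}" | "?N1 \<noteq> {}" "?N2 \<noteq> {}"
    by blast
  then show ?thesis
  proof cases
    case 1
    then have "\<forall>\<^sub>F n in sequentially. degrees A B n = {}" "\<forall>\<^sub>F n in sequentially. degrees B C n = {}"
      using AB BC unfolding linear_indeg_def by auto
    then have "\<forall>\<^sub>F n in sequentially. degrees A C n = {}"
      by eventually_elim (simp add: dU)
    then show ?thesis
      using 1 N unfolding linear_indeg_def by simp
  next
    case 2
    then have "\<forall>\<^sub>F n in sequentially. degrees A B n = {}"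
      using AB unfolding linear_indeg_def by simp
    then have "\<forall>\<^sub>F n in sequentially. degrees A C n = degrees B C n"
      by eventually_elim (simp add: dU)
    then show ?thesis
      using 2 N BC least_linear_cong unfolding linear_indeg_def by auto
  next
    case 3
    then have "\<forall>\<^sub>F n in sequentially. degrees B C n = {}"
      using BC unfolding linear_indeg_def by simp
    then have "\<forall>\<^sub>F n in sequentially. degrees A C n = degrees A B n"
      by eventually_elim (simp add: dU)
    then show ?thesis
      using 3 N AB least_linear_cong unfolding linear_indeg_def by auto
  next
    case 4
    let ?m1 = "Min ?N1" and ?m2 = "Min ?N2"
    have L: "least_linear (degrees A B) (int (dg ?m1))" "least_linear (degrees B C) (int (dg ?m2))"
      using 4 AB BC unfolding linear_indeg_def by auto
    have m: "?m1 \<in> {1..c}" "?m2 \<in> {1..c}"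
      by (rule in_range[OF 4(1) non_nilpotent_subset], rule in_range[OF 4(2) non_nilpotent_subset])
    have "Min (non_nilpotent l A C) = min ?m1 ?m2"
      unfolding N using 4 finite_non_nilpotent by (simp add: Min_Un)
    moreover have "least_linear (degrees A C) (int (dg (min ?m1 ?m2)))"
    proof (cases "?m1 \<le> ?m2")
      case True
      then show ?thesis
        using least_linear_Un[OF L] dg_le[OF m] by (simp add: dU[abs_def] min_def)
    next
      case False
      then show ?thesis
        using least_linear_Un[OF L(2,1)] dg_le[OF m(2,1)] by (simp add: dU[abs_def] min_def Un_commute)
    qed
    ultimately show ?thesis
      using 4 N unfolding linear_indeg_def by simp
  qed
qed

lemma linear_indeg_Suc:
  assumes "linear_indeg (Suc l) A B" and "nilpotent_on l A B"
  shows "linear_indeg l A B"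
proof -
  have "non_nilpotent l A B = non_nilpotent (Suc l) A B"
    unfolding non_nilpotent_def using assms(2) by (auto simp: le_eq_less_or_eq)
  then show ?thesis
    using assms(1) unfolding linear_indeg_def by simp
qed

text \<open>Multiplication by \<open>y l\<close> is injective on \<open>A/G\<close> and has the smallest degree among the
  \<open>y j\<close> that generate, so the lowest degree increases by exactly \<open>dg l\<close> in every step.\<close>

lemma linear_indeg_torsion_free:
  assumes A: "graded_family A" and G: "graded_family G"
    and gen: "eventually_generated (y ` {l..c}) A G"
    and inj: "\<And>n z. z \<in> A n \<Longrightarrow> y l *s z \<in> G (Suc n) \<Longrightarrow> z \<in> G n"
    and l: "l \<in> {1..c}"
  shows "linear_indeg l A G"
proof -
  obtain m where m: "\<And>n. n \<ge> m \<Longrightarrow> A (Suc n) \<subseteq> span (G (Suc n) \<union> {t *s z | t z. t \<in> y ` {l..c} \<and> z \<in> A n})"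
    using gen unfolding eventually_generated_def by blast
  \<comment> \<open>Otherwise every \<open>y j\<close> with \<open>j \<ge> l\<close>, being of
    degree at least \<open>dg l\<close>, would send \<open>A n\<close> to elements with all
    components up to \<open>u\<close> in \<open>G\<close>, and these generate
    \<open>A (Suc n)\<close> modulo \<open>G\<close>.\<close>
  have down: "\<exists>u'\<in>degrees A G n. u' + int (dg l) \<le> u" if n: "n \<ge> m" and u: "u \<in> degrees A G (Suc n)" for n u
  proof (rule ccontr)
    assume contra: "\<not> ?thesis"
    have low: "mcomp w v \<in> G n" if "w \<in> A n" "v + int (dg l) \<le> u" for v w
    proof -
      have "v \<notin> degrees A G n"
        using contra that(2) by blast
      then show ?thesis
        using graded_familyD(4)[OF A that(1), of v] mcomp_mem[of w v] unfolding degrees_def by blast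
    qed
    let ?X = "{x. \<forall>v\<le>u. mcomp x v \<in> G (Suc n)}"
    have "y j *s w \<in> ?X" if j: "j \<in> {l..c}" and w: "w \<in> A n" for j w
    proof -
      have j': "j \<in> {1..c}"
        using j l by simp
      have "mcomp w (v - int (dg j)) \<in> G n" if "v \<le> u" for v
        using low[OF w] dg_le[OF l j'] j that by simp
      then show ?thesis
        using graded_familyD(2)[OF G j'] mcomp_y[OF j'] by simp
    qed
    moreover have "G (Suc n) \<subseteq> ?X"
      using graded_familyD(4)[OF G] by blast
    ultimately have "G (Suc n) \<union> {t *s z | t z. t \<in> y ` {l..c} \<and> z \<in> A n} \<subseteq> ?X"
      by blast
    then have "span (G (Suc n) \<union> {t *s z | t z. t \<in> y ` {l..c} \<and> z \<in> A n}) \<subseteq> ?X"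
      by (intro span_minimal subspace_mcomp_le graded_familyD(1)[OF G])
    then have "A (Suc n) \<subseteq> ?X"
      using m[OF n] by blast
    moreover obtain z where "z \<in> A (Suc n)" "z \<in> Mg u" "z \<notin> G (Suc n)"
      using u unfolding degrees_def by blast
    ultimately have "mcomp z u \<in> G (Suc n)"
      by blast
    then show False
      using \<open>z \<in> Mg u\<close> \<open>z \<notin> G (Suc n)\<close> mcomp_self by simp
  qed
  have up: "u + int (dg l) \<in> degrees A G (Suc n)" if u: "u \<in> degrees A G n" for n u
  proof -
    obtain z where z: "z \<in> A n" "z \<in> Mg u" "z \<notin> G n"
      using u unfolding degrees_def by blast
    then have "y l *s z \<in> A (Suc n)" "y l *s z \<notin> G (Suc n)" "y l *s z \<in> Mg (u + int (dg l))"
      using graded_familyD(2)[OF A l] inj scale_mem_piece[OF y_mem[OF l], of z u] by (auto simp: add.commute)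
    then show ?thesis
      unfolding degrees_def by blast
  qed
  show ?thesis
  proof (cases "degrees A G m = {}")
    case True
    have empty: "degrees A G (m + k) = {}" for k
    proof (induction k)
      case (Suc k)
      then show ?case
        using down[of "m + k"] by auto
    qed (simp add: True)
    have "degrees A G n = {}" if "n \<ge> m" for n
      using empty[of "n - m"] that by simp
    then have "\<forall>\<^sub>F n in sequentially. degrees A G n = {}"
      by (rule eventually_sequentiallyI)
    \<comment> \<open>Exponent \<open>m\<close> moves everything to positions from \<open>m\<close>
      on, where \<open>A\<close> and \<open>G\<close> agree.\<close>
    moreover have "nilpotent_on j A G" if "j \<in> {l..c}" for j
    proof -
      have j: "j \<in> {1..c}"
        using that l by simp
      have "A (n + m) \<subseteq> G (n + m)" for n
        using degrees_empty_iff[OF A G, of "m + n"] empty[of n]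
        by (simp add: add.commute)
      then have "\<forall>n. \<forall>z\<in>A n. y j ^ m *s z \<in> G (n + m)"
        using graded_familyD(3)[OF A j] by blast
      then show ?thesis
        unfolding nilpotent_on_def by blast
    qed
    then have "non_nilpotent l A G = {}"
      unfolding non_nilpotent_def by blast
    ultimately show ?thesis
      unfolding linear_indeg_def by simp
  next
    case False
    obtain u0 where u0: "\<And>u. u < u0 \<Longrightarrow> Mg u \<subseteq> {0}"
      using bounded_below by blast
    have "u0 \<le> u" if "u \<in> degrees A G m" for u
    proof (rule ccontr)
      assume "\<not> u0 \<le> u"
      then have "A m \<inter> Mg u \<subseteq> {0}"
        using u0[of u] by auto
      also have "\<dots> \<subseteq> G m"
        using subspace_0[OF graded_familyD(1)[OF G]] by simp
      finally show False
        using that unfolding degrees_def by simp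
    qed
    then obtain b where b: "b \<in> degrees A G m" "\<And>u. u \<in> degrees A G m \<Longrightarrow> b \<le> u"
      using int_set_has_least[OF False] by blast
    have least: "b + int k * int (dg l) \<in> degrees A G (m + k) \<and> (\<forall>u\<in>degrees A G (m + k). b + int k * int (dg l) \<le> u)" for k
    proof (induction k)
      case 0
      then show ?case
        using b by simp
    next
      case (Suc k)
      have eq: "b + int (Suc k) * int (dg l) = (b + int k * int (dg l)) + int (dg l)"
        by (simp add: algebra_simps)
      have "b + int (Suc k) * int (dg l) \<le> u" if "u \<in> degrees A G (m + Suc k)" for u
        using down[of "m + k" u] that Suc eq by force
      moreover have "b + int (Suc k) * int (dg l) \<in> degrees A G (m + Suc k)"
        unfolding eq using up Suc by simp
      ultimately show ?case
        by blast
    qed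
    \<comment> \<open>The line of slope \<open>dg l\<close> that takes the value \<open>b\<close> at
      \<open>n = m\<close>.\<close>
    have "least_linear (degrees A G) (int (dg l))"
      unfolding least_linear_def
    proof (intro exI)
      show "\<forall>\<^sub>F n in sequentially. int (dg l) * int n + (b - int m * int (dg l)) \<in> degrees A G n
          \<and> (\<forall>u\<in>degrees A G n. int (dg l) * int n + (b - int m * int (dg l)) \<le> u)"
        using eventually_ge_at_top[of m]
      proof eventually_elim
        case (elim n)
        have eq: "int (dg l) * int n + (b - int m * int (dg l)) = b + int (n - m) * int (dg l)"
          using elim by (simp add: algebra_simps of_nat_diff)
        show ?case
          unfolding eq using least[of "n - m"] elim by (simp del: of_nat_diff)
      qed
    qed
    \<comment> \<open>Injectivity cancels powers of \<open>y l\<close>, so nilpotency would force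
      \<open>A m \<subseteq> G m\<close>. Hence \<open>l\<close> itself is the least non-nilpotent
      index, as the slope demands.\<close>
    moreover have "\<not> nilpotent_on l A G"
    proof
      assume "nilpotent_on l A G"
      then obtain k where k: "\<And>n z. z \<in> A n \<Longrightarrow> y l ^ k *s z \<in> G (n + k)"
        unfolding nilpotent_on_def by blast
      have "z \<in> G n" if "z \<in> A n" "y l ^ i *s z \<in> G (n + i)" for z n i
        using that
      proof (induction i arbitrary: z n)
        case (Suc i)
        then have "y l ^ i *s (y l *s z) \<in> G (Suc n + i)"
          by (simp add: mult.commute)
        then have "y l *s z \<in> G (Suc n)"
          using Suc.IH graded_familyD(2)[OF A l] Suc.prems(1) by blast
        then show ?case
          using inj Suc.prems(1) by blast
      qed simp
      then have "A m \<subseteq> G m"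
        using k by blast
      then show False
        using False degrees_empty_iff[OF A G] by simp
    qed
    then have "l \<in> non_nilpotent l A G"
      using l unfolding non_nilpotent_def by simp
    moreover then have "Min (non_nilpotent l A G) = l"
      using non_nilpotent_subset[of l A G] by (intro Min_eqI finite_non_nilpotent) auto
    ultimately show ?thesis
      unfolding linear_indeg_def by auto
  qed
qed

lemma graded_family_adjoin_image:
  assumes A: "graded_family A" and B: "graded_family B" and l: "l \<in> {1..c}"
  shows "graded_family (adjoin_image (y l) A B)"
  unfolding graded_family_def homogeneous_family_iff
proof (intro conjI allI ballI)
  show "stable_family (y ` {1..c}) (adjoin_image (y l) A B)"
    using A B unfolding graded_family_def by (intro stable_family_adjoin_image) auto
  fix n z u assume "z \<in> adjoin_image (y l) A B n"
  then consider "z \<in> B n" | b m a where "n = Suc m" "z = b + y l *s a" "b \<in> B n" "a \<in> A m"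
    unfolding adjoin_image_def by force
  then show "mcomp z u \<in> adjoin_image (y l) A B n"
  proof cases
    case 1
    then show ?thesis
      using graded_familyD(4)[OF B] le_adjoin_image unfolding le_fun_def by blast
  next
    case 2
    have "mcomp z u = mcomp b u + y l *s mcomp a (u - int (dg l))"
      using 2 mcomp_add mcomp_y[OF l] by simp
    then show ?thesis
      using 2 graded_familyD(4)[OF A] graded_familyD(4)[OF B] unfolding adjoin_image_def by blast
  qed
qed

text \<open>Induction on the exponent, with \<open>A'\<close> for \<open>B + y l A\<close>: the
  quotient \<open>A/A'\<close> needs only the operators after \<open>l\<close>, so that
  \<open>IH\<close> covers it, and on \<open>A'/B\<close> the exponent is one smaller.\<close>

lemma linear_indeg_nilpotent:
  assumes IH: "\<And>A B. graded_family A \<Longrightarrow> graded_family B \<Longrightarrow> B \<le> A \<Longrightarrow>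
      eventually_generated (y ` {Suc l..c}) A B \<Longrightarrow> linear_indeg (Suc l) A B"
    and l: "l \<in> {1..c}"
    and A: "graded_family A" and B: "graded_family B" and BA: "B \<le> A"
    and gen: "eventually_generated (y ` {l..c}) A B"
    and nil: "\<And>n z. z \<in> A n \<Longrightarrow> y l ^ k *s z \<in> B (n + k)"
  shows "linear_indeg l A B"
  using A BA gen nil
proof (induction k arbitrary: A)
  case 0
  then have "A n \<subseteq> B n" for n
    by force
  then have "degrees A B n = {}" "\<forall>n. \<forall>z\<in>A n. y j ^ 0 *s z \<in> B (n + 0)" for n j
    unfolding degrees_def by auto
  then have "degrees A B n = {}" "nilpotent_on j A B" for n j
    unfolding nilpotent_on_def by blast+
  then show ?case
    unfolding linear_indeg_def non_nilpotent_def by simp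
next
  case (Suc k)
  let ?A' = "adjoin_image (y l) A B"
  note A = Suc.prems(1)
  have l1: "1 \<le> l" and ins: "y ` {l..c} = insert (y l) (y ` {Suc l..c})"
    using l by (auto simp: image_iff Bex_def) (metis Suc_leI le_neq_implies_less)
  have st: "stable_family (y ` {l..c}) A" "stable_family (y ` {l..c}) B"
    using graded_familyD(5) A B l1 by blast+
  have A': "graded_family ?A'"
    using graded_family_adjoin_image A B l by blast
  have A'A: "?A' \<le> A"
    using adjoin_image_le[OF st(1) Suc.prems(2)] ins by blast
  have BA': "B \<le> ?A'"
    by (rule le_adjoin_image)
  have nil1: "nilpotent_on l A ?A'"
  proof -
    have "\<forall>n. \<forall>z\<in>A n. y l ^ 1 *s z \<in> ?A' (n + 1)"
      using image_mem_adjoin_image graded_familyD(1)[OF B] by simp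
    then show ?thesis
      unfolding nilpotent_on_def by blast
  qed
  have "eventually_generated (y ` {Suc l..c}) A ?A'"
    using st Suc.prems(3) unfolding ins by (rule eventually_generated_adjoin_image)
  then have "linear_indeg l A ?A'"
    using IH A A' A'A nil1 linear_indeg_Suc by blast
  moreover have "linear_indeg l ?A' B"
  proof (rule Suc.IH[OF A' BA'])
    have "acc_between (y ` {l..c}) A B"
      using st Suc.prems(2,3) by (intro acc_between_if_generated) auto
    then show "eventually_generated (y ` {l..c}) ?A' B"
      using st graded_familyD(5)[OF A' l1] BA' A'A by (rule eventually_generated_if_acc)
    show "y l ^ k *s z \<in> B (n + k)" if z: "z \<in> ?A' n" for n z
    proof -
      consider "z \<in> B n" | b m a where "n = Suc m" "z = b + y l *s a" "b \<in> B n" "a \<in> A m"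
        using z unfolding adjoin_image_def by force
      then show ?thesis
      proof cases
        case 1
        then show ?thesis
          using graded_familyD(3)[OF B l] by blast
      next
        case 2
        have "y l ^ k *s z = y l ^ k *s b + y l ^ Suc k *s a"
          using 2 by (simp add: scale_right_distrib mult.commute)
        moreover have "y l ^ k *s b \<in> B (n + k)" "y l ^ Suc k *s a \<in> B (n + k)"
          using graded_familyD(3)[OF B l 2(3), of k] Suc.prems(4)[of a m] 2 by (simp_all del: power_Suc)
        ultimately show ?thesis
          using subspace_add[OF graded_familyD(1)[OF B]] by simp
      qed
    qed
  qed
  ultimately show ?case
    using BA' A'A l1 linear_indeg_trans by blast
qed

section \<open>Torsion of a single operator\<close>

definition torsion :: "nat \<Rightarrow> (nat \<Rightarrow> 'b set) \<Rightarrow> (nat \<Rightarrow> 'b set) \<Rightarrow> nat \<Rightarrow> 'b set"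
  where "torsion j A B n = {z \<in> A n. \<exists>k. y j ^ k *s z \<in> B (n + k)}"

lemma power_mem_mono:
  assumes "graded_family B" and "j \<in> {1..c}" and "y j ^ k *s z \<in> B (n + k)" and "k \<le> k'"
  shows "y j ^ k' *s z \<in> B (n + k')"
proof -
  have "y j ^ (k' - k) *s (y j ^ k *s z) \<in> B (n + k + (k' - k))"
    using graded_familyD(3)[OF assms(1,2,3)] .
  then show ?thesis
    using assms(4) by (simp flip: power_add)
qed

lemma graded_family_bounded_torsion:
  assumes A: "graded_family A" and B: "graded_family B" and j: "j \<in> {1..c}"
  shows "graded_family (\<lambda>n. {z \<in> A n. y j ^ k *s z \<in> B (n + k)})"
proof (rule graded_familyI)
  fix n
  show "subspace {z \<in> A n. y j ^ k *s z \<in> B (n + k)}"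
    using graded_familyD(1)[OF A] graded_familyD(1)[OF B]
    by (auto intro!: subspaceI simp: subspace_0 subspace_add subspace_scale scale_right_distrib
        simp del: scale_scale, metis scale_left_commute subspace_scale)
next
  fix i n z assume i: "i \<in> {1..c}" and z: "z \<in> {z \<in> A n. y j ^ k *s z \<in> B (n + k)}"
  then have "y i *s (y j ^ k *s z) \<in> B (Suc (n + k))"
    using graded_familyD(2)[OF B i] by blast
  then show "y i *s z \<in> {z \<in> A (Suc n). y j ^ k *s z \<in> B (Suc n + k)}"
    using z graded_familyD(2)[OF A i] by (simp add: mult.commute)
next
  fix n z u assume z: "z \<in> {z \<in> A n. y j ^ k *s z \<in> B (n + k)}"
  then have "mcomp (y j ^ k *s z) (u + int (k * dg j)) \<in> B (n + k)"
    using graded_familyD(4)[OF B] by blast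
  then show "mcomp z u \<in> {z \<in> A n. y j ^ k *s z \<in> B (n + k)}"
    using z graded_familyD(4)[OF A] mcomp_y_power[OF j] by simp
qed

text \<open>The torsion is the ascending union of the families killed by a fixed power of
  \<open>y j\<close>. Under the chain condition it is reached at one exponent for all
  \<open>n\<close>, which upgrades torsion to nilpotency.\<close>

lemma torsion:
  assumes A: "graded_family A" and B: "graded_family B" and BA: "B \<le> A" and j: "j \<in> {1..c}"
  shows graded_family_torsion: "graded_family (torsion j A B)"
    and le_torsion: "B \<le> torsion j A B"
    and torsion_le: "torsion j A B \<le> A"
    and torsion_inj: "z \<in> A n \<Longrightarrow> y j *s z \<in> torsion j A B (Suc n) \<Longrightarrow> z \<in> torsion j A B n"
    and nilpotent_on_torsion: "acc_between (y ` {1..c}) A B \<Longrightarrow> nilpotent_on j (torsion j A B) B"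
proof -
  define C where "C k n = {z \<in> A n. y j ^ k *s z \<in> B (n + k)}" for k n
  have C: "graded_family (C k)" for k
    unfolding C_def[abs_def] using A B j by (rule graded_family_bounded_torsion)
  have inc: "incseq C"
    unfolding incseq_def C_def le_fun_def using power_mem_mono[OF B j] by blast
  have tors: "torsion j A B n = (\<Union>k. C k n)" for n
    unfolding torsion_def C_def by blast
  show "graded_family (torsion j A B)"
  proof (rule graded_familyI)
    show "subspace (torsion j A B n)" for n
      unfolding tors using graded_familyD(1)[OF C] inc
      by (intro subspace_incseq_Union) (auto simp: incseq_def le_fun_def)
    show "y i *s z \<in> torsion j A B (Suc n)" if "i \<in> {1..c}" "z \<in> torsion j A B n" for i n z
      using that graded_familyD(2)[OF C] unfolding tors by blast
    show "mcomp z u \<in> torsion j A B n" if "z \<in> torsion j A B n" for n z u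
      using that graded_familyD(4)[OF C] unfolding tors by blast
  qed
  show "torsion j A B \<le> A"
    unfolding torsion_def le_fun_def by blast
  have BC: "B \<le> C k" for k
    unfolding C_def using BA graded_familyD(3)[OF B j] by (auto simp: le_fun_def)
  then show "B \<le> torsion j A B"
    by (auto simp: tors le_fun_def)
  show "z \<in> torsion j A B n" if z: "z \<in> A n" and yz: "y j *s z \<in> torsion j A B (Suc n)"
  proof -
    obtain k where "y j ^ k *s (y j *s z) \<in> B (Suc n + k)"
      using yz unfolding torsion_def by blast
    then have "y j ^ Suc k *s z \<in> B (n + Suc k)"
      by (simp add: mult.commute)
    then show ?thesis
      unfolding torsion_def using z by blast
  qed
  show "nilpotent_on j (torsion j A B) B" if acc: "acc_between (y ` {1..c}) A B"
  proof -
    have "C k \<le> A" for k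
      unfolding C_def le_fun_def by blast
    then obtain K where K: "\<And>k. k \<ge> K \<Longrightarrow> C k = C K"
      using acc_betweenD[OF acc, of C] graded_familyD(5)[OF C] BC inc by auto
    have "y j ^ K *s z \<in> B (n + K)" if z: "z \<in> torsion j A B n" for n z
    proof -
      obtain k where "z \<in> C k n"
        using z unfolding tors by blast
      then have "z \<in> C (max k K) n"
        using inc unfolding incseq_def le_fun_def by (meson max.cobounded1 subsetD)
      then have "z \<in> C K n"
        using K[of "max k K"] by simp
      then show ?thesis
        unfolding C_def by blast
    qed
    then show ?thesis
      unfolding nilpotent_on_def by blast
  qed
qed

text \<open>More operators leave fewer stable families, hence fewer chains to test.\<close>

lemma acc_between_mono_ops:
  assumes "acc_between T A B" and "T \<subseteq> T'"
  shows "acc_between T' A B"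
  using assms stable_family_mono unfolding acc_between_def by blast

text \<open>Downward induction on \<open>l\<close>: modulo the \<open>y l\<close>-torsion \<open>G\<close>, the lowest degree is linear with
  slope \<open>dg l\<close>; on \<open>G/B\<close> the element \<open>y l\<close> is nilpotent and the filtration by the images of its
  powers has quotients generated by the remaining \<open>y j\<close>.\<close>

theorem linear_indeg_if_generated:
  assumes "1 \<le> l" and "l \<le> Suc c" and "graded_family A" and "graded_family B" and "B \<le> A"
    and "eventually_generated (y ` {l..c}) A B"
  shows "linear_indeg l A B"
  using assms(2,1,3-)
proof (induction l arbitrary: A B rule: inc_induct)
  \<comment> \<open>At \<open>l = Suc c\<close> no operator is left, so the pair vanishes in large
    degrees.\<close>
  case base
  then obtain m where m: "\<And>n. n \<ge> m \<Longrightarrow> A (Suc n) \<subseteq> span (B (Suc n) \<union> {t *s z | t z. t \<in> {} \<and> z \<in> A n})"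
    unfolding eventually_generated_def by auto
  have "span (B (Suc n) \<union> {t *s z | t z. t \<in> {} \<and> z \<in> A n}) \<subseteq> B (Suc n)" for n
    by (rule span_minimal) (auto simp: graded_familyD(1)[OF base.prems(3)])
  then have "A (Suc n) \<subseteq> B (Suc n)" if "n \<ge> m" for n
    using m[OF that] by blast
  then have "degrees A B n = {}" if "n \<ge> Suc m" for n
    using that by (cases n) (auto simp: degrees_def)
  then have "\<forall>\<^sub>F n in sequentially. degrees A B n = {}"
    by (rule eventually_sequentiallyI)
  then show ?case
    unfolding linear_indeg_def non_nilpotent_def by simp
next
  case (step l)
  note A = step.prems(2) and B = step.prems(3)
  have l: "l \<in> {1..c}"
    using step by simp
  let ?G = "torsion l A B"
  note G = torsion[OF A B step.prems(4) l]
  note st = graded_familyD(5)[OF A step.prems(1)] graded_familyD(5)[OF B step.prems(1)]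
  have acc: "acc_between (y ` {l..c}) A B"
    using st step.prems(4,5) by (intro acc_between_if_generated) auto
  have gen_G: "eventually_generated (y ` {l..c}) ?G B"
    using acc st graded_familyD(5)[OF G(1) step.prems(1)] G(2,3) by (rule eventually_generated_if_acc)
  have "acc_between (y ` {1..c}) A B"
    using acc by (rule acc_between_mono_ops) (use step.prems(1) in auto)
  then have "nilpotent_on l ?G B"
    by (rule G(5))
  then obtain k where k: "\<And>n z. z \<in> ?G n \<Longrightarrow> y l ^ k *s z \<in> B (n + k)"
    unfolding nilpotent_on_def by blast
  have GB: "linear_indeg l ?G B"
  proof (rule linear_indeg_nilpotent[OF _ l G(1) B G(2) gen_G k])
    show "linear_indeg (Suc l) A' B'" if "graded_family A'" "graded_family B'" "B' \<le> A'"
      "eventually_generated (y ` {Suc l..c}) A' B'" for A' B'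
      using that by (intro step.IH) auto
  qed
  have "eventually_generated (y ` {l..c}) A ?G"
    using step.prems(5) by (rule eventually_generated_mono) (use G(2) in simp)
  then have "linear_indeg l A ?G"
    using A G(1,4) l by (intro linear_indeg_torsion_free)
  with G(2,3) show ?case
    using GB step.prems(1) by (rule linear_indeg_trans)
qed

end

section \<open>Associated primes\<close>

lemma (in noetherian_module) exists_maximal_subspace:
  assumes "Q \<noteq> {}" and "\<And>S. S \<in> Q \<Longrightarrow> subspace S"
  shows "\<exists>S\<in>Q. \<forall>S'\<in>Q. S \<subseteq> S' \<longrightarrow> S' = S"
proof (rule ccontr)
  assume contra: "\<not> ?thesis"
  have "\<forall>S\<in>Q. \<exists>S'. S' \<in> Q \<and> S \<subset> S'"
    using contra by blast
  then obtain f where f: "\<And>S. S \<in> Q \<Longrightarrow> f S \<in> Q \<and> S \<subset> f S"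
    by metis
  obtain S0 where "S0 \<in> Q"
    using assms(1) by blast
  define C where "C n = (f ^^ n) S0" for n
  have C: "C n \<in> Q" for n
    by (induction n) (use \<open>S0 \<in> Q\<close> f in \<open>auto simp: C_def\<close>)
  have step: "C n \<subset> C (Suc n)" for n
    using f[OF C[of n]] by (simp add: C_def)
  then have "incseq C"
    by (intro incseq_SucI) blast
  then obtain k where k: "\<forall>n\<ge>k. C n = C k"
    using acc[of C] assms(2) C by blast
  have "C (Suc k) = C k"
    by (rule k[rule_format]) simp
  then show False
    using step[of k] by simp
qed

section \<open>Annihilators, colon modules and local torsion\<close>

context graded_operators
begin

definition annihilator :: "'b set \<Rightarrow> 'b \<Rightarrow> 'a set"
  where "annihilator S z = {r. r *s z \<in> S}"

definition homogeneous_prime :: "'a set \<Rightarrow> bool"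
  where "homogeneous_prime P \<longleftrightarrow> prime_ideal P \<and> homogeneous_subset Rg P"

definition associated :: "(nat \<Rightarrow> 'b set) \<Rightarrow> (nat \<Rightarrow> 'b set) \<Rightarrow> nat \<Rightarrow> 'a set set"
  where "associated A B n = {P. prime_ideal P \<and> (\<exists>z\<in>A n. P = annihilator (B n) z)}"

definition colon :: "'a set \<Rightarrow> (nat \<Rightarrow> 'b set) \<Rightarrow> (nat \<Rightarrow> 'b set) \<Rightarrow> nat \<Rightarrow> 'b set"
  where "colon P A B n = {z \<in> A n. \<forall>r\<in>P. r *s z \<in> B n}"

text \<open>For a homogeneous prime \<open>P\<close> this is, modulo \<open>B\<close>, the kernel of
  the homogeneous localization of the colon module at \<open>P\<close>.\<close>

definition local_torsion :: "'a set \<Rightarrow> (nat \<Rightarrow> 'b set) \<Rightarrow> (nat \<Rightarrow> 'b set) \<Rightarrow> nat \<Rightarrow> 'b set"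
  where "local_torsion P A B n = {z \<in> colon P A B n. \<exists>i. \<exists>s\<in>Rg i. s \<notin> P \<and> s *s z \<in> B n}"

definition v_degrees :: "'a set \<Rightarrow> (nat \<Rightarrow> 'b set) \<Rightarrow> (nat \<Rightarrow> 'b set) \<Rightarrow> nat \<Rightarrow> int set"
  where "v_degrees P A B n = {u. \<exists>z\<in>A n \<inter> Mg u. P = annihilator (B n) z}"

lemma ideal_annihilator:
  assumes "subspace S"
  shows "ideal (annihilator S z)"
proof (rule module.subspaceI[OF module_mult])
  show "0 \<in> annihilator S z"
    by (simp add: annihilator_def subspace_0[OF assms])
  show "r + r' \<in> annihilator S z" if "r \<in> annihilator S z" "r' \<in> annihilator S z" for r r'
    using that by (simp add: annihilator_def scale_left_distrib subspace_add[OF assms])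
  show "t * r \<in> annihilator S z" if "r \<in> annihilator S z" for t r
    using that subspace_scale[OF assms, of "r *s z" t] by (simp add: annihilator_def)
qed

lemma prime_ideal_ne_UNIV: "prime_ideal P \<Longrightarrow> P \<noteq> UNIV"
  unfolding prime_ideal_def by blast

lemma annihilator_eq_UNIV: "subspace S \<Longrightarrow> z \<in> S \<Longrightarrow> annihilator S z = UNIV"
  unfolding annihilator_def using subspace_scale by auto

lemma one_not_mem_prime: "prime_ideal P \<Longrightarrow> 1 \<notin> P"
  unfolding prime_ideal_def using module.subspace_scale[OF module_mult, of P 1] by auto

lemma homogeneous_subset_R: "homogeneous_subset Rg P \<longleftrightarrow> (\<forall>r\<in>P. \<forall>i. rcomp r i \<in> P)"
  by (rule homogeneous_subset_iff[OF direct_sum_R])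

lemma mcomp_scale_piece:
  assumes "z \<in> Mg u"
  shows "mcomp (r *s z) (u + int i) = rcomp r i *s z"
proof -
  have "mcomp (r *s z) (u + int i) = (\<Sum>k | rcomp r k \<noteq> 0. rcomp r k *s (if u + int i - int k = u then z else 0))"
    by (simp only: mcomp_scale mcomp_homogeneous[OF assms])
  also have "\<dots> = (\<Sum>k | rcomp r k \<noteq> 0. if k = i then rcomp r k *s z else 0)"
    by (rule sum.cong) auto
  also have "\<dots> = rcomp r i *s z"
    by (simp add: sum.delta finite_rcomp)
  finally show ?thesis .
qed

lemma rcomp_mem_annihilator:
  assumes "graded_family B" and "z \<in> Mg u" and "r \<in> annihilator (B n) z"
  shows "rcomp r i \<in> annihilator (B n) z"
  using graded_familyD(4)[OF assms(1), of "r *s z" n "u + int i"] mcomp_scale_piece[OF assms(2)] assms(3)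
  by (simp add: annihilator_def)

lemma annihilator_y_mono:
  assumes "graded_family B" and "j \<in> {1..c}"
  shows "annihilator (B n) z \<subseteq> annihilator (B (Suc n)) (y j *s z)"
proof
  fix r assume "r \<in> annihilator (B n) z"
  then have "y j *s (r *s z) \<in> B (Suc n)"
    using graded_familyD(2)[OF assms] unfolding annihilator_def by blast
  then show "r \<in> annihilator (B (Suc n)) (y j *s z)"
    by (simp add: annihilator_def mult.commute)
qed

text \<open>The components of highest degree outside \<open>P\<close> and \<open>K\<close>, respectively, will do.\<close>

lemma top_components:
  assumes K: "subspace K" "\<And>z u. z \<in> K \<Longrightarrow> mcomp z u \<in> K"
    and rw: "r *s w \<in> K" and P: "0 \<in> P"
    and kill: "\<And>i v. rcomp r i \<in> P \<Longrightarrow> rcomp r i *s mcomp w v \<in> K"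
    and r: "rcomp r i0 \<notin> P" and w: "mcomp w v0 \<notin> K"
  shows "\<exists>i v. rcomp r i \<notin> P \<and> mcomp w v \<notin> K \<and> rcomp r i *s mcomp w v \<in> K"
proof -
  define I where "I = {i. rcomp r i \<notin> P}"
  define V where "V = {v. mcomp w v \<notin> K}"
  have "I \<subseteq> {i. rcomp r i \<noteq> 0}" "V \<subseteq> {v. mcomp w v \<noteq> 0}"
    unfolding I_def V_def using P subspace_0[OF K(1)] by auto
  then have fin: "finite I" "finite V"
    using finite_rcomp finite_mcomp finite_subset by blast+
  define s where "s = Max I"
  define t where "t = Max V"
  have "I \<noteq> {}" "V \<noteq> {}"
    unfolding I_def V_def using r w by auto
  then have s: "rcomp r s \<notin> P" and t: "mcomp w t \<notin> K"
    using Max_in[OF fin(1)] Max_in[OF fin(2)] unfolding s_def t_def I_def V_def by auto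
  have s_max: "rcomp r i \<in> P" if "i > s" for i
    using Max_ge[OF fin(1), of i] that unfolding s_def[symmetric] by (auto simp: I_def)
  have t_max: "mcomp w v \<in> K" if "v > t" for v
    using Max_ge[OF fin(2), of v] that unfolding t_def[symmetric] by (auto simp: V_def)
  \<comment> \<open>In degree \<open>t + s\<close> of \<open>r *s w\<close>, every product other
    than that of the two top components has a factor of degree above \<open>s\<close> or above
    \<open>t\<close>, so it lies in \<open>K\<close>.\<close>
  have other: "rcomp r i *s mcomp w (t + int s - int i) \<in> K" if "i \<noteq> s" for i
  proof (cases "i > s")
    case True
    then show ?thesis
      using s_max kill by blast
  next
    case False
    then have "mcomp w (t + int s - int i) \<in> K"
      using that by (intro t_max) simp
    then show ?thesis
      by (rule subspace_scale[OF K(1)])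
  qed
  have "rcomp r s \<noteq> 0"
    using s P by metis
  then have "mcomp (r *s w) (t + int s) = rcomp r s *s mcomp w t
      + (\<Sum>i\<in>{i. rcomp r i \<noteq> 0} - {s}. rcomp r i *s mcomp w (t + int s - int i))"
    by (simp add: mcomp_scale sum.remove[OF finite_rcomp, of s])
  moreover have "(\<Sum>i\<in>{i. rcomp r i \<noteq> 0} - {s}. rcomp r i *s mcomp w (t + int s - int i)) \<in> K"
    using other by (intro subspace_sum[OF K(1)]) blast
  ultimately have "rcomp r s *s mcomp w t \<in> K"
    using K(2)[OF rw, of "t + int s"] subspace_diff[OF K(1)] by fastforce
  then show ?thesis
    using s t by blast
qed

lemma graded_family_colon:
  assumes A: "graded_family A" and B: "graded_family B" and P: "homogeneous_subset Rg P"
  shows "graded_family (colon P A B)"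
proof (rule graded_familyI)
  show "subspace (colon P A B n)" for n
  proof (rule subspaceI)
    show "0 \<in> colon P A B n"
      using graded_familyD(1)[OF A] graded_familyD(1)[OF B] by (simp add: colon_def subspace_0)
    show "x + z \<in> colon P A B n" if "x \<in> colon P A B n" "z \<in> colon P A B n" for x z
      using that graded_familyD(1)[OF A] graded_familyD(1)[OF B]
      by (simp add: colon_def subspace_add scale_right_distrib)
    show "r *s z \<in> colon P A B n" if z: "z \<in> colon P A B n" for r z
    proof -
      have "t *s (r *s z) \<in> B n" if "t \<in> P" for t
        using z that subspace_scale[OF graded_familyD(1)[OF B], of "t *s z" n r]
        by (simp add: colon_def mult.commute)
      then show ?thesis
        using z subspace_scale[OF graded_familyD(1)[OF A]] by (simp add: colon_def)
    qed
  qed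
  show "y j *s z \<in> colon P A B (Suc n)" if "j \<in> {1..c}" "z \<in> colon P A B n" for j n z
    using that graded_familyD(2)[OF A] annihilator_y_mono[OF B that(1), of n z]
    unfolding colon_def annihilator_def by blast
  show "mcomp z u \<in> colon P A B n" if z: "z \<in> colon P A B n" for n z u
  proof -
    \<comment> \<open>As \<open>P\<close> is homogeneous, \<open>r\<close> may be replaced by its
      components, each of which acts on the components of \<open>z\<close> with a mere shift of
      degree.\<close>
    have "r \<in> annihilator (B n) (mcomp z u)" if r: "r \<in> P" for r
    proof (rule mem_if_rcomp)
      show "ideal (annihilator (B n) (mcomp z u))"
        by (rule ideal_annihilator[OF graded_familyD(1)[OF B]])
      fix i
      have "rcomp r i *s z \<in> B n"
        using z r P unfolding homogeneous_subset_R colon_def by blast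
      then have "mcomp (rcomp r i *s z) (u + int i) \<in> B n"
        by (rule graded_familyD(4)[OF B])
      then show "rcomp r i \<in> annihilator (B n) (mcomp z u)"
        by (simp add: annihilator_def mcomp_scale_homogeneous[OF rcomp_mem])
    qed
    then show ?thesis
      using z graded_familyD(4)[OF A] unfolding colon_def annihilator_def by blast
  qed
qed

lemma le_colon: "graded_family B \<Longrightarrow> B \<le> A \<Longrightarrow> B \<le> colon P A B"
  unfolding colon_def le_fun_def using subspace_scale graded_familyD(1) by blast

lemma colon_le: "colon P A B \<le> A"
  unfolding colon_def le_fun_def by blast

text \<open>All \<open>n\<close> compete at once, so that one \<open>P\<close> serves the colon
  modules in every position; only homogeneous elements compete, so \<open>P\<close> is
  homogeneous.\<close>

definition maximal_annihilator :: "'a set \<Rightarrow> (nat \<Rightarrow> 'b set) \<Rightarrow> (nat \<Rightarrow> 'b set) \<Rightarrow> bool"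
  where "maximal_annihilator P A K \<longleftrightarrow>
    (\<exists>n u. \<exists>z\<in>A n \<inter> Mg u - K n. P = annihilator (K n) z) \<and>
    (\<forall>n u. \<forall>z\<in>A n \<inter> Mg u - K n. P \<subseteq> annihilator (K n) z \<longrightarrow> annihilator (K n) z = P)"

lemma exists_maximal_annihilator:
  assumes A: "graded_family A" and K: "graded_family K" and not_le: "\<not> A \<le> K"
  shows "\<exists>P. maximal_annihilator P A K"
proof -
  interpret R: noetherian_module "(*) :: 'a \<Rightarrow> 'a \<Rightarrow> 'a"
    by (rule noetherian_imp_noetherian_module[OF noetherian_ring])
  let ?Q = "{P. \<exists>n u. \<exists>z\<in>A n \<inter> Mg u - K n. P = annihilator (K n) z}"
  obtain n where "\<not> A n \<subseteq> K n"
    using not_le unfolding le_fun_def by blast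
  then have "degrees A K n \<noteq> {}"
    using degrees_empty_iff[OF A K] by simp
  then have "?Q \<noteq> {}"
    unfolding degrees_def by blast
  moreover have "R.subspace P" if "P \<in> ?Q" for P
    using that ideal_annihilator[OF graded_familyD(1)[OF K]] by blast
  ultimately have "\<exists>P\<in>?Q. \<forall>P'\<in>?Q. P \<subseteq> P' \<longrightarrow> P' = P"
    by (rule R.exists_maximal_subspace)
  then obtain P where P: "P \<in> ?Q" and max: "\<And>P'. P' \<in> ?Q \<Longrightarrow> P \<subseteq> P' \<Longrightarrow> P' = P"
    by auto
  have "annihilator (K n) z = P" if "z \<in> A n \<inter> Mg u - K n" "P \<subseteq> annihilator (K n) z" for n u z
    using that by (intro max) auto
  with P have "maximal_annihilator P A K"
    unfolding maximal_annihilator_def by auto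
  then show ?thesis ..
qed

text \<open>The point is that \<open>annihilator_colon\<close> holds for inhomogeneous
  \<open>w\<close> too: if \<open>r \<notin> P\<close> killed \<open>w\<close>, a component of
  \<open>r\<close> outside \<open>P\<close> would kill a component of \<open>w\<close> outside
  \<open>K n\<close>, against maximality. Primality follows by applying this to the possibly
  inhomogeneous \<open>b *s z\<close>.\<close>

lemma maximal_annihilator:
  assumes A: "graded_family A" and K: "graded_family K" and P: "maximal_annihilator P A K"
  shows maximal_annihilator_homogeneous: "homogeneous_subset Rg P"
    and annihilator_colon: "w \<in> colon P A K n \<Longrightarrow> w \<notin> K n \<Longrightarrow> annihilator (K n) w = P"
    and maximal_annihilator_prime: "prime_ideal P"
proof -
  obtain m u z where z: "z \<in> A m" "z \<in> Mg u" "z \<notin> K m" "P = annihilator (K m) z"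
    using P unfolding maximal_annihilator_def by blast
  have idP: "ideal P"
    unfolding z(4) by (rule ideal_annihilator[OF graded_familyD(1)[OF K]])
  show hom: "homogeneous_subset Rg P"
    unfolding homogeneous_subset_R z(4) using rcomp_mem_annihilator[OF K z(2)] by blast
  have ann: "annihilator (K n) w = P" if w: "w \<in> colon P A K n" "w \<notin> K n" for w n
  proof (rule antisym)
    show "P \<subseteq> annihilator (K n) w"
      using w(1) unfolding colon_def annihilator_def by blast
    show "annihilator (K n) w \<subseteq> P"
    proof (rule subsetI, rule ccontr)
      fix r assume r: "r \<in> annihilator (K n) w" "r \<notin> P"
      obtain i0 where i0: "rcomp r i0 \<notin> P"
        using r(2) mem_if_rcomp[OF idP] by blast
      obtain v0 where v0: "mcomp w v0 \<notin> K n"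
        using w(2) mem_if_mcomp[OF graded_familyD(1)[OF K]] by blast
      have comp: "mcomp w v \<in> colon P A K n" for v
        using graded_familyD(4)[OF graded_family_colon[OF A K hom] w(1)] .
      have "\<exists>i v. rcomp r i \<notin> P \<and> mcomp w v \<notin> K n \<and> rcomp r i *s mcomp w v \<in> K n"
      proof (rule top_components[OF _ _ _ _ _ i0 v0])
        show "subspace (K n)"
          by (rule graded_familyD(1)[OF K])
        show "mcomp x v \<in> K n" if "x \<in> K n" for x v
          using that by (rule graded_familyD(4)[OF K])
        show "r *s w \<in> K n"
          using r(1) by (simp add: annihilator_def)
        show "0 \<in> P"
          using module.subspace_0[OF module_mult idP] .
        show "rcomp r i *s mcomp w v \<in> K n" if "rcomp r i \<in> P" for i v
          using comp[of v] that unfolding colon_def by blast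
      qed
      then obtain i v where iv: "rcomp r i \<notin> P" "mcomp w v \<notin> K n" "rcomp r i *s mcomp w v \<in> K n"
        by blast
      have "mcomp w v \<in> A n \<inter> Mg v - K n" "P \<subseteq> annihilator (K n) (mcomp w v)"
        using comp[of v] iv(2) mcomp_mem[of w v] unfolding colon_def annihilator_def by blast+
      then have "annihilator (K n) (mcomp w v) = P"
        using P unfolding maximal_annihilator_def by blast
      then show False
        using iv(1,3) unfolding annihilator_def by blast
    qed
  qed
  then show "w \<in> colon P A K n \<Longrightarrow> w \<notin> K n \<Longrightarrow> annihilator (K n) w = P"
    by blast
  show "prime_ideal P"
    unfolding prime_ideal_def
  proof (intro conjI allI impI idP)
    show "P \<noteq> UNIV"
    proof
      assume "P = UNIV"
      then have "1 *s z \<in> K m"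
        using z(4) unfolding annihilator_def by blast
      then show False
        using z(3) by simp
    qed
    show "a \<in> P \<or> b \<in> P" if ab: "a * b \<in> P" for a b
    proof (rule disjCI)
      assume b: "b \<notin> P"
      have "b *s z \<in> colon P A K m"
        using z graded_familyD(1)[OF A] module.subspace_scale[OF module_mult idP, of _ b]
        unfolding colon_def annihilator_def by (auto simp: subspace_scale mult.commute)
      moreover have "b *s z \<notin> K m"
        using b z(4) unfolding annihilator_def by blast
      moreover have "a \<in> annihilator (K m) (b *s z)"
        using ab z(4) by (simp add: annihilator_def)
      ultimately show "a \<in> P"
        using ann by blast
    qed
  qed
qed

lemma associated_empty_if_le:
  assumes "graded_family B" and "A n \<subseteq> B n"
  shows "associated A B n = {}"
  using assms annihilator_eq_UNIV[OF graded_familyD(1)[OF assms(1)]] prime_ideal_ne_UNIV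
  unfolding associated_def by blast

text \<open>Either \<open>z\<close> keeps its annihilator modulo \<open>K\<close>, or some
  \<open>r *s z\<close> with \<open>r \<notin> P\<close> lies in \<open>K\<close> and has
  annihilator \<open>P\<close> again, by primality.\<close>

lemma associated_Un:
  assumes BK: "B \<le> K"
  shows "associated A B n \<subseteq> associated A K n \<union> associated K B n"
proof
  fix P assume "P \<in> associated A B n"
  then obtain z where P: "prime_ideal P" and z: "z \<in> A n" "P = annihilator (B n) z"
    unfolding associated_def by blast
  show "P \<in> associated A K n \<union> associated K B n"
  proof (cases "annihilator (K n) z \<subseteq> P")
    case True
    moreover have "P \<subseteq> annihilator (K n) z"
      using BK z(2) unfolding annihilator_def le_fun_def by blast
    ultimately show ?thesis
      using P z(1) unfolding associated_def by blast
  next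
    case False
    then obtain r where r: "r *s z \<in> K n" "r \<notin> P"
      unfolding annihilator_def by blast
    have "t \<in> annihilator (B n) (r *s z) \<longleftrightarrow> t * r \<in> P" for t
      using z(2) by (simp add: annihilator_def)
    moreover have "t * r \<in> P \<longleftrightarrow> t \<in> P" for t
      using P r(2) module.subspace_scale[OF module_mult, of P t r]
      unfolding prime_ideal_def by (auto simp: mult.commute)
    ultimately have "P = annihilator (B n) (r *s z)"
      by blast
    then show ?thesis
      using P r(1) unfolding associated_def by blast
  qed
qed

text \<open>Noetherian induction: passing from \<open>K\<close> to \<open>colon P A K\<close>, with \<open>P\<close> maximal among the
  annihilators of homogeneous elements of \<open>A/K\<close>, adds only \<open>P\<close> as an associated prime.\<close>

theorem finite_homogeneous_associated:
  assumes A: "graded_family A" and B: "graded_family B" and BA: "B \<le> A"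
    and acc: "acc_between (y ` {1..c}) A B"
  shows "\<exists>Ps. finite Ps \<and> (\<forall>P\<in>Ps. homogeneous_prime P) \<and> (\<forall>n. associated A B n \<subseteq> Ps)"
proof -
  define X where "X = {K. graded_family K \<and> B \<le> K \<and> K \<le> A}"
  \<comment> \<open>Larger families come first in this order, so its well-foundedness is the
    ascending chain condition.\<close>
  define rel where "rel = {(K', K). K' \<in> X \<and> K \<in> X \<and> K < K'}"
  have "wf rel"
    unfolding wf_iff_no_infinite_down_chain
  proof
    assume "\<exists>f. \<forall>i. (f (Suc i), f i) \<in> rel"
    then obtain f where f: "\<And>i. (f (Suc i), f i) \<in> rel"
      by blast
    have fX: "f i \<in> X" and less: "f i < f (Suc i)" for i
      using f[of i] unfolding rel_def by auto
    have "incseq f"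
      using less by (intro incseq_SucI) (simp add: less_imp_le)
    moreover have "stable_family (y ` {1..c}) (f i)" "B \<le> f i" "f i \<le> A" for i
      using fX[of i] unfolding X_def graded_family_def by auto
    ultimately obtain k where k: "\<forall>i\<ge>k. f i = f k"
      using acc_betweenD[OF acc, of f] by blast
    have "f (Suc k) = f k"
      by (rule k[rule_format]) simp
    then show False
      using less[of k] by simp
  qed
  then have "\<exists>Ps. finite Ps \<and> (\<forall>P\<in>Ps. homogeneous_prime P) \<and> (\<forall>n. associated A K n \<subseteq> Ps)" if "K \<in> X" for K
    using that
  proof (induction K rule: wf_induct_rule)
    case (less K)
    then have K: "graded_family K" "B \<le> K" "K \<le> A"
      unfolding X_def by auto
    show ?case
    proof (cases "A \<le> K")
      case True
      then have "associated A K n = {}" for n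
        by (intro associated_empty_if_le[OF K(1)]) (simp add: le_fun_def)
      then show ?thesis
        by (intro exI[of _ "{}"]) simp
    next
      case False
      then obtain P where P: "maximal_annihilator P A K"
        using exists_maximal_annihilator[OF A K(1)] by blast
      note max = maximal_annihilator[OF A K(1) P]
      let ?K' = "colon P A K"
      have K': "graded_family ?K'"
        using A K(1) max(1) by (rule graded_family_colon)
      have KK': "K \<le> ?K'"
        using K(1,3) by (rule le_colon)
      \<comment> \<open>The witness for \<open>P\<close> lies in the colon module but not in
        \<open>K\<close>, so the step is proper.\<close>
      obtain n u z where z: "z \<in> A n \<inter> Mg u - K n" "P = annihilator (K n) z"
        using P unfolding maximal_annihilator_def by blast
      then have "z \<in> ?K' n"
        unfolding colon_def annihilator_def by blast
      then have "K n \<noteq> ?K' n"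
        using z(1) by blast
      then have "K \<noteq> ?K'"
        by metis
      then have "(?K', K) \<in> rel"
        using K K' KK' colon_le[of P A K] unfolding rel_def X_def by auto
      moreover from this have "?K' \<in> X"
        unfolding rel_def by blast
      ultimately have "\<exists>Ps. finite Ps \<and> (\<forall>P\<in>Ps. homogeneous_prime P) \<and> (\<forall>n. associated A ?K' n \<subseteq> Ps)"
        by (rule less.IH)
      then obtain Ps where Ps: "finite Ps" "\<forall>P\<in>Ps. homogeneous_prime P" "\<And>n. associated A ?K' n \<subseteq> Ps"
        by blast
      have sub: "associated ?K' K n \<subseteq> {P}" for n
      proof
        fix Q assume "Q \<in> associated ?K' K n"
        then obtain w where Q: "prime_ideal Q" "w \<in> ?K' n" "Q = annihilator (K n) w"
          unfolding associated_def by blast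
        then have "w \<notin> K n"
          using annihilator_eq_UNIV[OF graded_familyD(1)[OF K(1)]] prime_ideal_ne_UNIV by blast
        then show "Q \<in> {P}"
          using max(2) Q by simp
      qed
      have "associated A K n \<subseteq> insert P Ps" for n
        using associated_Un[OF KK', of A n] sub[of n] Ps(3)[of n] by blast
      moreover have "homogeneous_prime P"
        unfolding homogeneous_prime_def using max(1,3) by blast
      ultimately show ?thesis
        using Ps(1,2) by (intro exI[of _ "insert P Ps"]) simp
    qed
  qed
  then show ?thesis
    using B BA unfolding X_def by simp
qed

section \<open>The v-number as an initial degree\<close>

lemma graded_family_local_torsion:
  assumes A: "graded_family A" and B: "graded_family B" and P: "homogeneous_prime P"
  shows "graded_family (local_torsion P A B)"
proof -
  have prime: "prime_ideal P" and hom: "homogeneous_subset Rg P"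
    using P unfolding homogeneous_prime_def by auto
  note C = graded_family_colon[OF A B hom]
  note B1 = graded_familyD(1)[OF B] and C1 = graded_familyD(1)[OF C]
  show ?thesis
  proof (rule graded_familyI)
    show "subspace (local_torsion P A B n)" for n
    proof (rule subspaceI)
      have "1 \<in> Rg 0"
        using graded_R unfolding graded_ring_def by blast
      then show "0 \<in> local_torsion P A B n"
        unfolding local_torsion_def using one_not_mem_prime[OF prime] subspace_0[OF C1] subspace_0[OF B1]
        by auto
    next
      fix x z assume "x \<in> local_torsion P A B n" "z \<in> local_torsion P A B n"
      then obtain i s j t where x: "x \<in> colon P A B n" "s \<in> Rg i" "s \<notin> P" "s *s x \<in> B n"
        and z: "z \<in> colon P A B n" "t \<in> Rg j" "t \<notin> P" "t *s z \<in> B n"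
        unfolding local_torsion_def by blast
      \<comment> \<open>A sum is killed by the product of the two multipliers, which avoids
        \<open>P\<close> by primality.\<close>
      have "s * t \<in> Rg (i + j)"
        using graded_R x z unfolding graded_ring_def by blast
      moreover have "s * t \<notin> P"
        using prime x z unfolding prime_ideal_def by blast
      moreover have "t *s (s *s x) + s *s (t *s z) \<in> B n"
        by (rule subspace_add[OF B1 subspace_scale[OF B1 x(4)] subspace_scale[OF B1 z(4)]])
      then have "(s * t) *s (x + z) \<in> B n"
        by (simp add: scale_right_distrib mult.commute)
      ultimately show "x + z \<in> local_torsion P A B n"
        unfolding local_torsion_def using x z subspace_add[OF C1] by blast
    next
      fix r z assume "z \<in> local_torsion P A B n"
      then obtain i s where z: "z \<in> colon P A B n" "s \<in> Rg i" "s \<notin> P" "s *s z \<in> B n"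
        unfolding local_torsion_def by blast
      then have "s *s (r *s z) \<in> B n"
        using subspace_scale[OF B1, of "s *s z" n r] by (simp add: mult.commute)
      then show "r *s z \<in> local_torsion P A B n"
        unfolding local_torsion_def using z subspace_scale[OF C1] by blast
    qed
  next
    fix j n z assume j: "j \<in> {1..c}" and "z \<in> local_torsion P A B n"
    then obtain i s where z: "z \<in> colon P A B n" "s \<in> Rg i" "s \<notin> P" "s \<in> annihilator (B n) z"
      unfolding local_torsion_def annihilator_def by blast
    then have "s *s (y j *s z) \<in> B (Suc n)"
      using annihilator_y_mono[OF B j] unfolding annihilator_def by blast
    then show "y j *s z \<in> local_torsion P A B (Suc n)"
      unfolding local_torsion_def using z graded_familyD(2)[OF C j] by blast
  next
    fix n z u assume "z \<in> local_torsion P A B n"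
    then obtain i s where z: "z \<in> colon P A B n" "s \<in> Rg i" "s \<notin> P" "s *s z \<in> B n"
      unfolding local_torsion_def by blast
    then have "s *s mcomp z u \<in> B n"
      using graded_familyD(4)[OF B, of "s *s z" n "u + int i"] mcomp_scale_homogeneous[OF z(2)] by simp
    then show "mcomp z u \<in> local_torsion P A B n"
      unfolding local_torsion_def using z graded_familyD(4)[OF C] by blast
  qed
qed

lemma le_local_torsion:
  assumes "graded_family B" and "B \<le> A" and "homogeneous_prime P"
  shows "B \<le> local_torsion P A B"
proof (rule le_funI, rule subsetI)
  fix n z assume z: "z \<in> B n"
  have "1 \<in> Rg 0" "1 \<notin> P"
    using graded_R one_not_mem_prime assms(3) unfolding graded_ring_def homogeneous_prime_def by auto
  moreover have "z \<in> colon P A B n"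
    using le_colon[OF assms(1,2)] z unfolding le_fun_def by blast
  ultimately show "z \<in> local_torsion P A B n"
    unfolding local_torsion_def using z by (auto intro!: exI[of _ 0] bexI[of _ 1])
qed

lemma local_torsion_le: "local_torsion P A B \<le> colon P A B"
  unfolding local_torsion_def le_fun_def by blast

text \<open>For homogeneous \<open>z\<close> in the colon module the annihilator contains
  \<open>P\<close> and is homogeneous. It exceeds \<open>P\<close> exactly if it has a homogeneous
  element outside \<open>P\<close>, that is, if \<open>z\<close> is local torsion.\<close>

lemma v_degrees_eq:
  assumes B: "graded_family B" and P: "homogeneous_prime P"
  shows "v_degrees P A B n = degrees (colon P A B) (local_torsion P A B) n"
proof (intro set_eqI iffI)
  fix u assume "u \<in> v_degrees P A B n"
  then obtain z where "z \<in> A n" "z \<in> Mg u" "P = annihilator (B n) z"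
    unfolding v_degrees_def by blast
  then show "u \<in> degrees (colon P A B) (local_torsion P A B) n"
    unfolding degrees_def colon_def local_torsion_def annihilator_def by blast
next
  fix u assume "u \<in> degrees (colon P A B) (local_torsion P A B) n"
  then obtain z where z: "z \<in> colon P A B n" "z \<in> Mg u" "z \<notin> local_torsion P A B n"
    unfolding degrees_def by blast
  have "annihilator (B n) z \<subseteq> P"
  proof
    fix r assume r: "r \<in> annihilator (B n) z"
    have "rcomp r i \<in> P" for i
      using rcomp_mem_annihilator[OF B z(2) r, of i] rcomp_mem[of r i] z(1,3)
      unfolding local_torsion_def annihilator_def by blast
    then show "r \<in> P"
      using mem_if_rcomp P unfolding homogeneous_prime_def prime_ideal_def by blast
  qed
  moreover have "P \<subseteq> annihilator (B n) z" "z \<in> A n"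
    using z(1) unfolding colon_def annihilator_def by blast+
  ultimately show "u \<in> v_degrees P A B n"
    using z(2) unfolding v_degrees_def by blast
qed

text \<open>An element with annihilator \<open>P\<close> need not be homogeneous, but it lies in the
  colon module and outside the local torsion, and a nonzero graded quotient is nonzero in some
  degree.\<close>

lemma associated_iff_v_degrees:
  assumes A: "graded_family A" and B: "graded_family B" and P: "homogeneous_prime P"
  shows "P \<in> associated A B n \<longleftrightarrow> v_degrees P A B n \<noteq> {}"
proof
  have prime: "prime_ideal P" and hom: "homogeneous_subset Rg P"
    using P unfolding homogeneous_prime_def by auto
  show "P \<in> associated A B n" if "v_degrees P A B n \<noteq> {}"
    using that prime unfolding v_degrees_def associated_def by blast
  assume "P \<in> associated A B n"
  then obtain z where z: "z \<in> A n" "P = annihilator (B n) z"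
    unfolding associated_def by blast
  then have "z \<in> colon P A B n" "z \<notin> local_torsion P A B n"
    unfolding colon_def local_torsion_def annihilator_def by blast+
  then show "v_degrees P A B n \<noteq> {}"
    unfolding v_degrees_eq[OF B P]
    using degrees_empty_iff[OF graded_family_colon[OF A B hom] graded_family_local_torsion[OF A B P]] by blast
qed

text \<open>Modulo the \<open>y j\<close>-torsion there is an associated prime \<open>P\<close>, the annihilator of some
  homogeneous \<open>z\<close>; as \<open>P\<close> is finitely generated, it is the annihilator of \<open>(y j)\<^sup>k z\<close> modulo
  \<open>B\<close> for all large \<open>k\<close>.\<close>

lemma non_nilpotent_at_prime:
  assumes A: "graded_family A" and B: "graded_family B" and BA: "B \<le> A"
    and acc: "acc_between (y ` {1..c}) A B"
    and j: "j \<in> {1..c}" and nonnil: "\<not> nilpotent_on j A B"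
  shows "\<exists>P. homogeneous_prime P \<and> \<not> nilpotent_on j (colon P A B) (local_torsion P A B)"
proof -
  interpret R: noetherian_module "(*) :: 'a \<Rightarrow> 'a \<Rightarrow> 'a"
    by (rule noetherian_imp_noetherian_module[OF noetherian_ring])
  let ?K = "torsion j A B"
  note K = torsion[OF A B BA j]
  have "\<not> A \<le> ?K"
    using nilpotent_on_mono[OF K(5)[OF acc] _ order_refl] nonnil by blast
  then obtain P where P: "maximal_annihilator P A ?K"
    using exists_maximal_annihilator[OF A K(1)] by blast
  note max = maximal_annihilator[OF A K(1) P]
  obtain n z where z: "z \<in> A n" "P = annihilator (?K n) z"
    using P unfolding maximal_annihilator_def by blast
  define L where "L k = annihilator (B (n + k)) (y j ^ k *s z)" for k
  have mem_L: "r \<in> L k \<longleftrightarrow> y j ^ k *s (r *s z) \<in> B (n + k)" for r k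
    unfolding L_def annihilator_def by (simp add: mult.commute)
  have "incseq L"
    unfolding incseq_def using power_mem_mono[OF B j] mem_L by blast
  moreover have "R.subspace (L k)" for k
    unfolding L_def by (rule ideal_annihilator[OF graded_familyD(1)[OF B]])
  ultimately obtain k0 where k0: "\<forall>k\<ge>k0. L k = L k0"
    using R.acc[of L] by blast
  \<comment> \<open>Torsion means being sent into \<open>B\<close> by some power of
    \<open>y j\<close>, so the annihilator modulo torsion is the union of the
    \<open>L k\<close>.\<close>
  have "P = (\<Union>k. L k)"
  proof (intro set_eqI)
    fix r
    have "r *s z \<in> A n"
      using z(1) subspace_scale[OF graded_familyD(1)[OF A]] by blast
    then show "r \<in> P \<longleftrightarrow> r \<in> (\<Union>k. L k)"
      unfolding z(2) by (simp add: annihilator_def torsion_def mem_L)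
  qed
  have L: "L k = P" if "k \<ge> k0" for k
  proof -
    have "L i \<subseteq> L k0" for i
      using \<open>incseq L\<close> k0 unfolding incseq_def by (metis nat_le_linear order_refl)
    then show ?thesis
      using k0 that \<open>P = (\<Union>k. L k)\<close> by blast
  qed
  have large: "y j ^ k *s z \<in> colon P A B (n + k) - local_torsion P A B (n + k)" if "k \<ge> k0" for k
  proof -
    have "P = annihilator (B (n + k)) (y j ^ k *s z)"
      using L[OF that] unfolding L_def by simp
    moreover have "y j ^ k *s z \<in> A (n + k)"
      using graded_familyD(3)[OF A j z(1)] .
    ultimately show ?thesis
      unfolding colon_def local_torsion_def annihilator_def by blast
  qed
  \<comment> \<open>All higher powers of \<open>y j\<close> keep \<open>y j ^ k0 *s z\<close>
    outside the local torsion, so no exponent can serve.\<close>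
  have "\<not> nilpotent_on j (colon P A B) (local_torsion P A B)"
  proof
    assume "nilpotent_on j (colon P A B) (local_torsion P A B)"
    then obtain e where "\<And>m w. w \<in> colon P A B m \<Longrightarrow> y j ^ e *s w \<in> local_torsion P A B (m + e)"
      unfolding nilpotent_on_def by blast
    then have "y j ^ e *s (y j ^ k0 *s z) \<in> local_torsion P A B (n + k0 + e)"
      using large[of k0] by blast
    then have "y j ^ (k0 + e) *s z \<in> local_torsion P A B (n + (k0 + e))"
      by (simp add: power_add add.assoc mult.commute)
    then show False
      using large[of "k0 + e"] by simp
  qed
  moreover have "homogeneous_prime P"
    unfolding homogeneous_prime_def using max by blast
  ultimately show ?thesis
    by blast
qed

text \<open>Each candidate prime has a pair of its own: if \<open>N P\<close> is empty, the pair
  dies out and \<open>P\<close> is eventually not associated; otherwise \<open>P\<close> is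
  eventually associated, with slope \<open>dg (Min (N P))\<close>. As the candidates are finitely
  many, this happens simultaneously.\<close>

theorem v_numbers_eventually_linear:
  assumes A: "graded_family A" and B: "graded_family B" and BA: "B \<le> A"
    and gen: "eventually_generated (y ` {1..c}) A B"
  shows "\<exists>Ps. finite Ps \<and> (\<forall>\<^sub>F n in sequentially. associated A B n = Ps) \<and>
    (\<forall>P\<in>Ps. \<exists>j\<in>non_nilpotent 1 A B. least_linear (v_degrees P A B) (int (dg j))) \<and>
    (Ps \<noteq> {} \<longrightarrow> (\<exists>\<delta>\<in>non_nilpotent 1 A B. \<delta> = Min (non_nilpotent 1 A B) \<and>
      least_linear (degrees A B) (int (dg \<delta>)) \<and>
      (\<exists>P\<in>Ps. least_linear (v_degrees P A B) (int (dg \<delta>)))))"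
proof -
  note st = graded_familyD(5)[OF A order_refl] graded_familyD(5)[OF B order_refl]
  have acc: "acc_between (y ` {1..c}) A B"
    using st BA gen by (intro acc_between_if_generated) auto
  obtain Qs where Qs: "finite Qs" "\<And>P. P \<in> Qs \<Longrightarrow> homogeneous_prime P" "\<And>n. associated A B n \<subseteq> Qs"
    using finite_homogeneous_associated[OF A B BA acc] by blast
  define N where "N P = non_nilpotent 1 (colon P A B) (local_torsion P A B)" for P
  \<comment> \<open>The pair of \<open>P\<close> lies between \<open>B\<close> and \<open>A\<close>,
    so operators nilpotent on \<open>A/B\<close> stay nilpotent; this is the lower bound for the
    slopes.\<close>
  have N_sub: "N P \<subseteq> non_nilpotent 1 A B" if "homogeneous_prime P" for P
    using nilpotent_on_mono[OF _ colon_le le_local_torsion[OF B BA that]]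
    unfolding N_def non_nilpotent_def by blast
  have lin: "linear_indeg 1 (colon P A B) (local_torsion P A B)" if P: "homogeneous_prime P" for P
  proof -
    have C: "graded_family (colon P A B)"
      using A B P unfolding homogeneous_prime_def by (intro graded_family_colon) auto
    have "eventually_generated (y ` {1..c}) (colon P A B) B"
      using acc st graded_familyD(5)[OF C order_refl] le_colon[OF B BA] colon_le
      by (rule eventually_generated_if_acc)
    then have "eventually_generated (y ` {1..c}) (colon P A B) (local_torsion P A B)"
      using le_local_torsion[OF B BA P] by (rule eventually_generated_mono)
    then show ?thesis
      using C graded_family_local_torsion[OF A B P] local_torsion_le
      by (intro linear_indeg_if_generated) auto
  qed
  have v: "v_degrees P A B = degrees (colon P A B) (local_torsion P A B)" if "homogeneous_prime P" for P
    using v_degrees_eq[OF B that] by (rule ext)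
  have lin_N: "least_linear (v_degrees P A B) (int (dg (Min (N P))))" if "homogeneous_prime P" "N P \<noteq> {}" for P
    using lin[OF that(1)] that(2) unfolding v[OF that(1)] linear_indeg_def N_def by blast
  have empty_N: "\<forall>\<^sub>F n in sequentially. v_degrees P A B n = {}" if "homogeneous_prime P" "N P = {}" for P
    using lin[OF that(1)] that(2) unfolding v[OF that(1)] linear_indeg_def N_def by blast
  define Ps where "Ps = {P \<in> Qs. N P \<noteq> {}}"
  have ev: "\<forall>\<^sub>F n in sequentially. P \<in> associated A B n \<longleftrightarrow> N P \<noteq> {}" if "homogeneous_prime P" for P
  proof (cases "N P = {}")
    case True
    show ?thesis
      using empty_N[OF that True]
      by eventually_elim (use associated_iff_v_degrees[OF A B that] True in simp)
  next
    case False
    show ?thesis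
      using least_linear_nonempty[OF lin_N[OF that False]]
      by eventually_elim (use associated_iff_v_degrees[OF A B that] False in simp)
  qed
  have mem_Qs: "P \<in> Qs" if P: "homogeneous_prime P" "N P \<noteq> {}" for P
  proof -
    have "\<forall>\<^sub>F n in sequentially. P \<in> associated A B n"
      using ev[OF P(1)] P(2) by simp
    then obtain n where "P \<in> associated A B n"
      using eventually_happens'[OF sequentially_bot] by blast
    then show ?thesis
      using Qs(3) by blast
  qed
  \<comment> \<open>Finiteness of \<open>Qs\<close> moves the quantifier over primes inside the
    eventual statement.\<close>
  have "\<forall>\<^sub>F n in sequentially. \<forall>P\<in>Qs. P \<in> associated A B n \<longleftrightarrow> N P \<noteq> {}"
    using Qs(1,2) ev by (intro eventually_ball_finite) auto
  then have assoc: "\<forall>\<^sub>F n in sequentially. associated A B n = Ps"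
  proof eventually_elim
    case (elim n)
    then show ?case
      using Qs(3)[of n] unfolding Ps_def by blast
  qed
  have Ps: "\<exists>j\<in>non_nilpotent 1 A B. least_linear (v_degrees P A B) (int (dg j))" if "P \<in> Ps" for P
  proof -
    have P: "homogeneous_prime P" "N P \<noteq> {}"
      using that Qs(2) unfolding Ps_def by auto
    moreover have "Min (N P) \<in> N P"
      using P(2) unfolding N_def by (intro Min_in finite_non_nilpotent)
    ultimately show ?thesis
      using N_sub lin_N by blast
  qed
  have "\<exists>\<delta>\<in>non_nilpotent 1 A B. \<delta> = Min (non_nilpotent 1 A B) \<and>
      least_linear (degrees A B) (int (dg \<delta>)) \<and>
      (\<exists>P\<in>Ps. least_linear (v_degrees P A B) (int (dg \<delta>)))" if "Ps \<noteq> {}"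
  proof -
    let ?\<delta> = "Min (non_nilpotent 1 A B)"
    have ne: "non_nilpotent 1 A B \<noteq> {}"
      using Ps that by blast
    have \<delta>: "?\<delta> \<in> non_nilpotent 1 A B"
      using ne by (intro Min_in finite_non_nilpotent)
    have "linear_indeg 1 A B"
      using A B BA gen by (intro linear_indeg_if_generated) auto
    then have "least_linear (degrees A B) (int (dg ?\<delta>))"
      using ne unfolding linear_indeg_def by blast
    have "?\<delta> \<in> {1..c}" "\<not> nilpotent_on ?\<delta> A B"
      using \<delta> unfolding non_nilpotent_def by auto
    then obtain P where P: "homogeneous_prime P" "\<not> nilpotent_on ?\<delta> (colon P A B) (local_torsion P A B)"
      using non_nilpotent_at_prime[OF A B BA acc] by blast
    then have "?\<delta> \<in> N P"
      using \<open>?\<delta> \<in> {1..c}\<close> unfolding N_def non_nilpotent_def by blast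
    moreover have "Min (N P) = ?\<delta>"
      using N_sub[OF P(1)] \<open>?\<delta> \<in> N P\<close> finite_non_nilpotent
      by (intro Min_eqI) (auto simp: N_def)
    moreover have "P \<in> Ps"
      using mem_Qs[OF P(1)] \<open>?\<delta> \<in> N P\<close> unfolding Ps_def by blast
    ultimately have "\<exists>P\<in>Ps. least_linear (v_degrees P A B) (int (dg ?\<delta>))"
      using lin_N[OF P(1)] by (metis empty_iff)
    then show ?thesis
      using \<delta> \<open>least_linear (degrees A B) _\<close> by blast
  qed
  moreover have "finite Ps"
    unfolding Ps_def using Qs(1) by simp
  ultimately show ?thesis
    using assoc Ps by blast
qed

end

section \<open>Products of ideals and submodules\<close>

context module
begin

lemma subspace_ideal_smult: "subspace (ideal_smult scale I X)"
  unfolding ideal_smult_def by simp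

lemma mem_ideal_smult: "r \<in> I \<Longrightarrow> z \<in> X \<Longrightarrow> r *s z \<in> ideal_smult scale I X"
  unfolding ideal_smult_def by (rule span_base) blast

lemma ideal_smult_subset:
  assumes "subspace S" and "\<And>r z. r \<in> I \<Longrightarrow> z \<in> X \<Longrightarrow> r *s z \<in> S"
  shows "ideal_smult scale I X \<subseteq> S"
  unfolding ideal_smult_def using assms by (intro span_minimal) auto

lemma ideal_smult_mono: "X \<subseteq> X' \<Longrightarrow> ideal_smult scale I X \<subseteq> ideal_smult scale I X'"
  by (intro ideal_smult_subset subspace_ideal_smult mem_ideal_smult) auto

lemma ideal_smult_UNIV: "subspace N \<Longrightarrow> ideal_smult scale UNIV N = N"
proof
  assume N: "subspace N"
  then show "ideal_smult scale UNIV N \<subseteq> N"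
    by (intro ideal_smult_subset subspace_scale)
  show "N \<subseteq> ideal_smult scale UNIV N"
    using mem_ideal_smult[of 1 UNIV _ N] by auto
qed

lemma subspace_scale_preimage:
  assumes "subspace S"
  shows "subspace {w. \<forall>r\<in>I. r *s w \<in> S}"
  using assms by (intro subspaceI) (auto simp: subspace_0 subspace_add scale_right_distrib
      scale_left_commute subspace_scale simp del: scale_scale)

text \<open>A target ideal: products with an ideal then need to be checked only on generators of
  that ideal.\<close>

lemma ideal_multipliers:
  assumes "subspace S"
  shows "ideal {r. \<forall>z\<in>X. r *s z \<in> S}"
proof (rule module.subspaceI[OF module_mult])
  show "c * r \<in> {r. \<forall>z\<in>X. r *s z \<in> S}" if "r \<in> {r. \<forall>z\<in>X. r *s z \<in> S}" for c r
    using that subspace_scale[OF assms] by (auto simp flip: scale_scale)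
qed (use assms in \<open>auto simp: subspace_0 subspace_add scale_left_distrib\<close>)

lemma ideal_smult_assoc:
  "ideal_smult scale (ideal_smult (*) I K) X = ideal_smult scale I (ideal_smult scale K X)"
proof
  let ?L = "ideal_smult scale (ideal_smult (*) I K) X"
  let ?R = "ideal_smult scale I (ideal_smult scale K X)"
  have "ideal_smult (*) I K \<subseteq> {r. \<forall>z\<in>X. r *s z \<in> ?R}"
    by (rule module.ideal_smult_subset[OF module_mult ideal_multipliers[OF subspace_ideal_smult]])
      (auto simp: mem_ideal_smult simp flip: scale_scale)
  then show "?L \<subseteq> ?R"
    by (intro ideal_smult_subset subspace_ideal_smult) blast
  have "ideal_smult scale K X \<subseteq> {w. \<forall>r\<in>I. r *s w \<in> ?L}"
    by (rule ideal_smult_subset[OF subspace_scale_preimage[OF subspace_ideal_smult]])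
      (auto intro!: mem_ideal_smult module.mem_ideal_smult[OF module_mult])
  then show "?R \<subseteq> ?L"
    by (intro ideal_smult_subset subspace_ideal_smult) blast
qed

lemma ideal_smult_commute:
  "ideal_smult scale I (ideal_smult scale K X) = ideal_smult scale K (ideal_smult scale I X)"
proof -
  have "ideal_smult (*) I K = ideal_smult (*) K I"
    unfolding ideal_smult_def by (rule arg_cong[where f = ideal_gen]) (blast intro: mult.commute)
  then show ?thesis
    by (simp flip: ideal_smult_assoc)
qed

lemma ideal_smult_power_0: "subspace N \<Longrightarrow> ideal_smult scale (ideal_power I 0) N = N"
  by (simp add: ideal_power_def ideal_smult_UNIV)

lemma ideal_smult_power_Suc:
  "ideal_smult scale (ideal_power I (Suc n)) N = ideal_smult scale I (ideal_smult scale (ideal_power I n) N)"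
  by (simp add: ideal_power_def ideal_smult_assoc)

text \<open>The defining equation persists beyond \<open>m\<close>, since multiplication by
  \<open>I\<close> commutes with multiplication by \<open>J\<close>.\<close>

lemma reduction_smult_power:
  assumes "is_reduction J I"
  shows "\<exists>m. \<forall>n\<ge>m. ideal_smult scale (ideal_power I (Suc n)) N =
    ideal_smult scale J (ideal_smult scale (ideal_power I n) N)"
proof -
  obtain m where m: "ideal_smult (*) J (ideal_power I m) = ideal_power I (Suc m)"
    using assms unfolding is_reduction_def by blast
  have "ideal_smult scale (ideal_power I (Suc n)) N =
    ideal_smult scale J (ideal_smult scale (ideal_power I n) N)" if "n \<ge> m" for n
    using that
  proof (induction n rule: dec_induct)
    case base
    then show ?case
      by (simp flip: m add: ideal_smult_assoc)
  next
    case (step n)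
    have "ideal_smult scale (ideal_power I (Suc (Suc n))) N
        = ideal_smult scale I (ideal_smult scale (ideal_power I (Suc n)) N)"
      by (rule ideal_smult_power_Suc)
    also have "\<dots> = ideal_smult scale J (ideal_smult scale I (ideal_smult scale (ideal_power I n) N))"
      unfolding step.IH by (rule ideal_smult_commute)
    finally show ?case
      by (simp only: ideal_smult_power_Suc)
  qed
  then show ?thesis
    by blast
qed

end

lemma zero_mem_ideal_power: "0 \<in> ideal_power I n"
proof (cases n)
  case (Suc k)
  then show ?thesis
    using module.subspace_0[OF module_mult module.subspace_ideal_smult[OF module_mult]]
    by (simp add: ideal_power_def)
qed (simp add: ideal_power_def)

lemma power_mem_ideal_power: "a \<in> I \<Longrightarrow> a ^ n \<in> ideal_power I n"
  by (induction n) (simp_all add: ideal_power_def module.mem_ideal_smult[OF module_mult])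

section \<open>The families \<open>I^n N\<close> and their generation through a reduction\<close>

context graded_operators
begin

lemma homogeneous_subset_M: "homogeneous_subset Mg S \<longleftrightarrow> (\<forall>z\<in>S. \<forall>u. mcomp z u \<in> S)"
  by (rule homogeneous_subset_iff[OF direct_sum_M])

lemma homogeneous_ideal_smult:
  assumes "homogeneous_subset Rg I" and "homogeneous_subset Mg X"
  shows "homogeneous_subset Mg (ideal_smult scale I X)"
proof -
  let ?S = "ideal_smult scale I X"
  note sub = subspace_ideal_smult[of I X]
  have "subspace {z. \<forall>u. mcomp z u \<in> ?S}"
    by (rule subspaceI) (auto simp: mcomp_zero mcomp_add mcomp_scale subspace_0[OF sub]
        intro!: subspace_add[OF sub] subspace_sum[OF sub] subspace_scale[OF sub])
  then have "?S \<subseteq> {z. \<forall>u. mcomp z u \<in> ?S}"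
  proof (rule ideal_smult_subset)
    fix r z assume "r \<in> I" "z \<in> X"
    then have "rcomp r i \<in> I" "mcomp z u \<in> X" for i u
      using assms unfolding homogeneous_subset_R homogeneous_subset_M by auto
    then show "r *s z \<in> {z. \<forall>u. mcomp z u \<in> ?S}"
      by (auto simp: mcomp_scale intro!: subspace_sum[OF sub] mem_ideal_smult)
  qed
  then show ?thesis
    unfolding homogeneous_subset_M by blast
qed

definition powers :: "'a set \<Rightarrow> 'b set \<Rightarrow> nat \<Rightarrow> 'b set"
  where "powers I N n = ideal_smult scale (ideal_power I n) N"

lemma graded_family_powers:
  assumes "homogeneous_subset Rg I" and "subspace N" and "homogeneous_subset Mg N"
    and "\<And>j. j \<in> {1..c} \<Longrightarrow> y j \<in> I"
  shows "graded_family (powers I N)"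
  unfolding graded_family_def stable_family_def homogeneous_family_def powers_def
proof (intro conjI allI ballI subspace_ideal_smult)
  show "t *s z \<in> ideal_smult scale (ideal_power I (Suc n)) N"
    if "t \<in> y ` {1..c}" "z \<in> ideal_smult scale (ideal_power I n) N" for n t z
    using that assms(4) by (auto simp: ideal_smult_power_Suc intro: mem_ideal_smult)
  show "homogeneous_subset Mg (ideal_smult scale (ideal_power I n) N)" for n
    by (induction n)
      (simp_all add: assms ideal_smult_power_0 ideal_smult_power_Suc homogeneous_ideal_smult)
qed

lemma powers_mono: "N \<subseteq> N' \<Longrightarrow> powers I N \<le> powers I N'"
  unfolding powers_def le_fun_def by (simp add: ideal_smult_mono)

text \<open>Here the reduction equation enters: the step from \<open>n\<close> to
  \<open>n + 1\<close> is multiplication by \<open>I\<close>, but for large \<open>n\<close> it is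
  already multiplication by \<open>J\<close>, hence by the \<open>y j\<close>.\<close>

lemma eventually_generated_powers:
  assumes "is_reduction J I" and "J = ideal_gen (y ` {1..c})"
  shows "eventually_generated (y ` {1..c}) (powers I N) B"
proof -
  obtain m where m: "\<And>n. n \<ge> m \<Longrightarrow> powers I N (Suc n) = ideal_smult scale J (powers I N n)"
    using reduction_smult_power[OF assms(1), of N] unfolding powers_def by blast
  have "ideal_smult scale J X \<subseteq> span (Y \<union> {t *s z | t z. t \<in> y ` {1..c} \<and> z \<in> X})" for X Y
  proof -
    let ?S = "span (Y \<union> {t *s z | t z. t \<in> y ` {1..c} \<and> z \<in> X})"
    have "J \<subseteq> {r. \<forall>z\<in>X. r *s z \<in> ?S}"
      unfolding assms(2)
    proof (rule module.span_minimal[OF module_mult _ ideal_multipliers[OF subspace_span]])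
      show "y ` {1..c} \<subseteq> {r. \<forall>z\<in>X. r *s z \<in> ?S}"
        by (auto intro!: span_base)
    qed
    then show ?thesis
      by (intro ideal_smult_subset subspace_span) blast
  qed
  then have "powers I N (Suc n) \<subseteq> span (B (Suc n) \<union> {t *s z | t z. t \<in> y ` {1..c} \<and> z \<in> powers I N n})"
    if "n \<ge> m" for n
    unfolding m[OF that] .
  then show ?thesis
    unfolding eventually_generated_def by blast
qed

end

section \<open>Quotient modules\<close>

context module
begin

lemma coset_eq_self_iff:
  assumes "subspace B"
  shows "coset B z = B \<longleftrightarrow> z \<in> B"
proof
  assume "coset B z = B"
  then show "z \<in> B"
    using subspace_0[OF assms] unfolding coset_def by (metis add.right_neutral image_eqI)
next
  assume z: "z \<in> B"
  have "b \<in> (\<lambda>b. z + b) ` B" if "b \<in> B" for b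
    using subspace_diff[OF assms that z] by (intro image_eqI[of _ _ "b - z"]) auto
  then show "coset B z = B"
    unfolding coset_def using subspace_add[OF assms z] by blast
qed

lemma mact_coset:
  assumes "subspace B"
  shows "{r *s x + b | x b. x \<in> coset B z \<and> b \<in> B} = coset B (r *s z)"
proof (intro set_eqI iffI)
  fix w assume "w \<in> {r *s x + b | x b. x \<in> coset B z \<and> b \<in> B}"
  then obtain b b' where "w = r *s (z + b') + b" "b \<in> B" "b' \<in> B"
    unfolding coset_def by blast
  then have "w = r *s z + (r *s b' + b)" "r *s b' + b \<in> B"
    using assms by (simp_all add: scale_right_distrib subspace_add subspace_scale)
  then show "w \<in> coset B (r *s z)"
    unfolding coset_def by blast
next
  fix w assume "w \<in> coset B (r *s z)"
  then obtain b where b: "w = r *s z + b" "b \<in> B"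
    unfolding coset_def by blast
  moreover have "z \<in> coset B z"
    unfolding coset_def using subspace_0[OF assms] by force
  ultimately show "w \<in> {r *s x + b | x b. x \<in> coset B z \<and> b \<in> B}"
    by blast
qed

end

section \<open>Translation of the quotient modules into pairs\<close>

context graded_operators
begin

lemma power_quotient_eq:
  "power_quotient scale Mg I N n = graded_quotient scale Mg (powers I UNIV n) (powers I N n)"
  unfolding power_quotient_def powers_def ..

lemma graded_quotient_simps:
  "mcarrier (graded_quotient scale Mg A B) = coset B ` A"
  "mzero (graded_quotient scale Mg A B) = B"
  "mact (graded_quotient scale Mg A B) r X = {r *s x + b | x b. x \<in> X \<and> b \<in> B}"
  "piece (graded_quotient scale Mg A B) u = coset B ` (A \<inter> Mg u)"
  unfolding graded_quotient_def quotient_module_def rmodule.extend_def gmodule.fields_def by simp_all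

lemma elt_ann_coset:
  assumes "subspace B"
  shows "elt_ann (graded_quotient scale Mg A B) (coset B z) = annihilator B z"
  unfolding elt_ann_def annihilator_def graded_quotient_simps
  by (simp add: mact_coset[OF assms] coset_eq_self_iff[OF assms])

lemma Ass_graded_quotient:
  assumes "\<And>n. subspace (B n)"
  shows "Ass (graded_quotient scale Mg (A n) (B n)) = associated A B n"
  unfolding Ass_def associated_def graded_quotient_simps by (auto simp: elt_ann_coset[OF assms])

lemma v_number_at_graded_quotient:
  assumes "\<And>n. subspace (B n)"
  shows "v_number_at P (graded_quotient scale Mg (A n) (B n)) = (INF u\<in>v_degrees P A B n. ereal (of_int u))"
  unfolding v_number_at_def v_degrees_def graded_quotient_simps
  by (rule arg_cong[where f = "\<lambda>S. INF u\<in>S. ereal (of_int u)"]) (auto simp: elt_ann_coset[OF assms])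

lemma indeg_graded_quotient:
  assumes A: "\<And>n. subspace (A n)" and B: "\<And>n. subspace (B n)"
  shows "indeg (graded_quotient scale Mg (A n) (B n)) = (INF u\<in>degrees A B n. ereal (of_int u))"
proof -
  have "coset (B n) ` (A n \<inter> Mg u) \<noteq> {B n} \<longleftrightarrow> \<not> A n \<inter> Mg u \<subseteq> B n" for u
  proof -
    \<comment> \<open>The zero coset always occurs in the image, so differing from
      \<open>{B n}\<close> means containing a nonzero coset.\<close>
    have "0 \<in> A n \<inter> Mg u"
      using subspace_0[OF A] direct_sum_closed(1)[OF direct_sum_M] by blast
    then have "coset (B n) ` (A n \<inter> Mg u) = {B n} \<longleftrightarrow> (\<forall>z\<in>A n \<inter> Mg u. coset (B n) z = B n)"
      by blast
    then show ?thesis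
      by (auto simp: coset_eq_self_iff[OF B])
  qed
  then show ?thesis
    unfolding indeg_def degrees_def graded_quotient_simps by simp
qed

end

lemma eventually_linear_INF:
  assumes "least_linear S a"
  shows "eventually_linear (\<lambda>n. INF u\<in>S n. ereal (of_int u)) a"
proof -
  obtain b where "\<forall>\<^sub>F n in sequentially. a * int n + b \<in> S n \<and> (\<forall>u\<in>S n. a * int n + b \<le> u)"
    using assms unfolding least_linear_def by blast
  then have "\<forall>\<^sub>F n in sequentially. (INF u\<in>S n. ereal (of_int u)) = ereal (of_int (a * int n + b))"
  proof eventually_elim
    case (elim n)
    show ?case
    proof (rule antisym)
      show "(INF u\<in>S n. ereal (of_int u)) \<le> ereal (of_int (a * int n + b))"
        using elim by (intro INF_lower) blast
      show "ereal (of_int (a * int n + b)) \<le> (INF u\<in>S n. ereal (of_int u))"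
        using elim by (intro INF_greatest) (simp only: ereal_less_eq of_int_le_iff)
    qed
  qed
  then show ?thesis
    unfolding eventually_linear_def by blast
qed

lemma eventually_linear_cong:
  assumes "\<forall>\<^sub>F n in sequentially. f n = g n" and "eventually_linear g a"
  shows "eventually_linear f a"
proof -
  obtain b where "\<forall>\<^sub>F n in sequentially. g n = ereal (of_int (a * int n + b))"
    using assms(2) unfolding eventually_linear_def by blast
  with assms(1) have "\<forall>\<^sub>F n in sequentially. f n = ereal (of_int (a * int n + b))"
    by eventually_elim simp
  then show ?thesis
    unfolding eventually_linear_def by blast
qed

section \<open>Nilpotency in the Rees algebra\<close>

lemma (in module) lookup_rees_scale_monom:
  "Poly_Mapping.lookup (rees_scale scale (monom a k) h) m =
    (if k \<le> m then a *s Poly_Mapping.lookup h (m - k) else 0)"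
proof (cases "a = 0")
  case True
  then show ?thesis
    by (simp add: rees_scale_def)
next
  \<comment> \<open>Only for \<open>a \<noteq> 0\<close> is \<open>monom a k\<close> sure to have
    degree \<open>k\<close>, so that the outer sum reaches its one nonzero term.\<close>
  case False
  have inner: "(\<Sum>q\<in>Poly_Mapping.keys h. Poly_Mapping.single (i + q) (coeff (monom a k) i *s Poly_Mapping.lookup h q))
      = (if i = k then (\<Sum>q\<in>Poly_Mapping.keys h. Poly_Mapping.single (k + q) (a *s Poly_Mapping.lookup h q)) else 0)" for i
    by simp
  have "rees_scale scale (monom a k) h =
      (\<Sum>q\<in>Poly_Mapping.keys h. Poly_Mapping.single (k + q) (a *s Poly_Mapping.lookup h q))"
    unfolding rees_scale_def inner using False by (simp add: degree_monom_eq)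
  then have "Poly_Mapping.lookup (rees_scale scale (monom a k) h) m =
      (\<Sum>q\<in>Poly_Mapping.keys h. if k + q = m then a *s Poly_Mapping.lookup h q else 0)"
    by (simp add: lookup_sum lookup_single when_def)
  also have "\<dots> = (\<Sum>q\<in>Poly_Mapping.keys h. if q = m - k then (if k \<le> m then a *s Poly_Mapping.lookup h q else 0) else 0)"
    by (rule sum.cong) auto
  also have "\<dots> = (if k \<le> m then a *s Poly_Mapping.lookup h (m - k) else 0)"
    by (simp add: in_keys_iff)
  finally show ?thesis .
qed

context graded_operators
begin

text \<open>A monomial acts by a scalar and a shift, so annihilation can be tested on sequences
  supported at a single position; this takes nilpotency from the Rees algebra to the pair.\<close>

lemma module_ann_rees_quotient_iff:
  assumes N: "subspace N" and S: "monom a k \<in> S"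
  shows "monom a k \<in> module_ann S (rees_quotient scale I N) \<longleftrightarrow>
    (\<forall>n. \<forall>z\<in>powers I UNIV n. a *s z \<in> powers I N (n + k))"
proof -
  let ?B = "rees_module scale I N" and ?A = "rees_module scale I UNIV"
  have mem_rees: "h \<in> rees_module scale I X \<longleftrightarrow> (\<forall>n. Poly_Mapping.lookup h n \<in> powers I X n)" for h X
    unfolding rees_module_def powers_def by blast
  have sub: "subspace (powers I X n)" for X n
    unfolding powers_def by (rule subspace_ideal_smult)
  have BA: "h \<in> ?B \<Longrightarrow> h \<in> ?A" for h
    using powers_mono[of N UNIV I] unfolding mem_rees le_fun_def by blast
  have add: "h + h' \<in> rees_module scale I X" if "h \<in> rees_module scale I X" "h' \<in> rees_module scale I X" for h h' X
    using that unfolding mem_rees by (simp add: lookup_add subspace_add[OF sub])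
  have diff: "h - h' \<in> ?B" if "h \<in> ?B" "h' \<in> ?B" for h h'
    using that unfolding mem_rees by (simp add: lookup_minus subspace_diff[OF sub])
  have zero: "0 \<in> ?B"
    unfolding mem_rees by (simp add: subspace_0[OF sub])
  have act: "mact (rees_quotient scale I N) p X = {rees_scale scale p x + b | x b. x \<in> X \<and> b \<in> ?B}"
    and carrier: "mcarrier (rees_quotient scale I N) = coset ?B ` ?A"
    and mz: "mzero (rees_quotient scale I N) = ?B" for p X
    unfolding rees_quotient_def quotient_module_def by simp_all
  have "monom a k \<in> module_ann S (rees_quotient scale I N) \<longleftrightarrow> (\<forall>h\<in>?A. rees_scale scale (monom a k) h \<in> ?B)"
  proof
    assume ann: "monom a k \<in> module_ann S (rees_quotient scale I N)"
    show "\<forall>h\<in>?A. rees_scale scale (monom a k) h \<in> ?B"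
    proof
      fix h assume "h \<in> ?A"
      then have "{rees_scale scale (monom a k) x + b | x b. x \<in> coset ?B h \<and> b \<in> ?B} = ?B"
        using ann unfolding module_ann_def carrier mz act by blast
      moreover have "h \<in> coset ?B h"
        unfolding coset_def using zero by force
      ultimately show "rees_scale scale (monom a k) h \<in> ?B"
        using zero by (metis (mono_tags, lifting) add.right_neutral mem_Collect_eq)
    qed
  next
    assume kill: "\<forall>h\<in>?A. rees_scale scale (monom a k) h \<in> ?B"
    have "{rees_scale scale (monom a k) x + b | x b. x \<in> coset ?B h \<and> b \<in> ?B} = ?B" (is "?L = ?B") if h: "h \<in> ?A" for h
    proof
      have in_A: "x \<in> ?A" if "x \<in> coset ?B h" for x
        using that add[OF h] BA unfolding coset_def by blast
      then show "?L \<subseteq> ?B"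
        using kill add by blast
      show "?B \<subseteq> ?L"
      proof
        fix b assume b: "b \<in> ?B"
        have "h \<in> coset ?B h"
          unfolding coset_def using zero by force
        moreover have "b = rees_scale scale (monom a k) h + (b - rees_scale scale (monom a k) h)"
          by simp
        moreover have "b - rees_scale scale (monom a k) h \<in> ?B"
          using diff b kill h by blast
        ultimately show "b \<in> ?L"
          by blast
      qed
    qed
    then show "monom a k \<in> module_ann S (rees_quotient scale I N)"
      using S unfolding module_ann_def carrier mz act by blast
  qed
  also have "\<dots> \<longleftrightarrow> (\<forall>n. \<forall>z\<in>powers I UNIV n. a *s z \<in> powers I N (n + k))"
  proof
    assume kill: "\<forall>h\<in>?A. rees_scale scale (monom a k) h \<in> ?B"
    show "\<forall>n. \<forall>z\<in>powers I UNIV n. a *s z \<in> powers I N (n + k)"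
    proof (intro allI ballI)
      fix n z assume "z \<in> powers I UNIV n"
      then have "Poly_Mapping.single n z \<in> ?A"
        unfolding mem_rees by (simp add: lookup_single when_def subspace_0[OF sub])
      then have "rees_scale scale (monom a k) (Poly_Mapping.single n z) \<in> ?B"
        using kill by blast
      then have "Poly_Mapping.lookup (rees_scale scale (monom a k) (Poly_Mapping.single n z)) (n + k) \<in> powers I N (n + k)"
        unfolding mem_rees by (rule spec)
      then show "a *s z \<in> powers I N (n + k)"
        by (simp add: lookup_rees_scale_monom lookup_single)
    qed
  next
    assume kill: "\<forall>n. \<forall>z\<in>powers I UNIV n. a *s z \<in> powers I N (n + k)"
    show "\<forall>h\<in>?A. rees_scale scale (monom a k) h \<in> ?B"
    proof
      fix h assume h: "h \<in> ?A"
      have "Poly_Mapping.lookup (rees_scale scale (monom a k) h) m \<in> powers I N m" for m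
      proof (cases "k \<le> m")
        case True
        have "Poly_Mapping.lookup h (m - k) \<in> powers I UNIV (m - k)"
          using h unfolding mem_rees by (rule spec)
        then have "a *s Poly_Mapping.lookup h (m - k) \<in> powers I N (m - k + k)"
          using kill by blast
        then show ?thesis
          using True by (simp add: lookup_rees_scale_monom)
      qed (simp add: lookup_rees_scale_monom subspace_0[OF sub])
      then show "rees_scale scale (monom a k) h \<in> ?B"
        unfolding mem_rees by blast
    qed
  qed
  finally show ?thesis .
qed

lemma monom_mem_rees_algebra: "a \<in> ideal_power J k \<Longrightarrow> monom a k \<in> rees_algebra J"
  unfolding rees_algebra_def by (simp add: coeff_monom zero_mem_ideal_power)

lemma non_nilpotent_indices_eq:
  assumes N: "subspace N" and J: "\<And>j. j \<in> {1..c} \<Longrightarrow> y j \<in> J"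
    and B: "graded_family (powers I N)"
  shows "non_nilpotent_indices scale I N J y c = non_nilpotent 1 (powers I UNIV) (powers I N)"
proof -
  let ?S = "rees_algebra J"
  have "monom (y j) 1 \<in> radical_in ?S (module_ann ?S (rees_quotient scale I N)) \<longleftrightarrow>
      nilpotent_on j (powers I UNIV) (powers I N)" if j: "j \<in> {1..c}" for j
  proof -
    have mem: "monom (y j ^ k) k \<in> ?S" for k
      by (rule monom_mem_rees_algebra[OF power_mem_ideal_power[OF J[OF j]]])
    have "monom (y j) 1 \<in> radical_in ?S (module_ann ?S (rees_quotient scale I N)) \<longleftrightarrow>
      (\<exists>k>0. \<forall>n. \<forall>z\<in>powers I UNIV n. y j ^ k *s z \<in> powers I N (n + k))"
      using mem[of 1] unfolding radical_in_def
      by (simp add: monom_power module_ann_rees_quotient_iff[OF N mem])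
    also have "\<dots> \<longleftrightarrow> nilpotent_on j (powers I UNIV) (powers I N)"
    proof
      assume "nilpotent_on j (powers I UNIV) (powers I N)"
      then obtain k where "\<And>n z. z \<in> powers I UNIV n \<Longrightarrow> y j ^ k *s z \<in> powers I N (n + k)"
        unfolding nilpotent_on_def by blast
      \<comment> \<open>\<open>radical_in\<close> asks for a positive exponent while
        \<open>nilpotent_on\<close> allows 0; one more factor \<open>y j\<close> bridges the
        difference.\<close>
      then have "\<forall>n. \<forall>z\<in>powers I UNIV n. y j ^ Suc k *s z \<in> powers I N (n + Suc k)"
        using power_mem_mono[OF B j] by (meson le_SucI order_refl)
      then show "\<exists>k>0. \<forall>n. \<forall>z\<in>powers I UNIV n. y j ^ k *s z \<in> powers I N (n + k)"
        by blast
    qed (auto simp: nilpotent_on_def)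
    finally show ?thesis .
  qed
  then show ?thesis
    unfolding non_nilpotent_indices_def non_nilpotent_def by blast
qed

end

section \<open>The pair of \<open>I^n M\<close> and \<open>I^n N\<close>\<close>

theorem theorem2p11:
  fixes Rg :: "nat \<Rightarrow> 'a::comm_ring_1 set"
    and x :: "nat \<Rightarrow> 'a" and d :: nat and e :: "nat \<Rightarrow> nat"
    and scale :: "'a \<Rightarrow> 'b::ab_group_add \<Rightarrow> 'b"
    and Mg :: "int \<Rightarrow> 'b set" and N :: "'b set"
    and I J :: "'a set"
    and y :: "nat \<Rightarrow> 'a" and c :: nat and dg :: "nat \<Rightarrow> nat"
    and \<delta> :: nat
  assumes "noetherian TYPE('a)"
    and "graded_ring Rg"
    and "\<And>i. i \<in> {1..d} \<Longrightarrow> x i \<in> Rg (e i) \<and> e i \<ge> 1"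
    and "is_subring hull (Rg 0 \<union> x ` {1..d}) = UNIV"
    and "graded_module Rg scale Mg"
    and "\<exists>S. finite S \<and> module.span scale S = UNIV"
    and "module.subspace scale N" and "homogeneous_subset Mg N"
    and "ideal I" and "homogeneous_subset Rg I"
    and "is_reduction J I"
    and "J = ideal_gen (y ` {1..c})"
    and "\<And>j. j \<in> {1..c} \<Longrightarrow> y j \<in> Rg (dg j)"
    and "mono_on {1..c} dg"
    and "\<delta> = Inf (non_nilpotent_indices scale I N J y c)"
    and "stable_Ass scale Mg I N \<noteq> {}"
  shows "\<delta> \<in> {1..c}
    \<and> (\<forall>\<pp>\<in>stable_Ass scale Mg I N. \<exists>a\<in>dg ` {\<delta>..c}.
          eventually_linear (\<lambda>n. v_number_at \<pp> (power_quotient scale Mg I N n)) (int a))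
    \<and> eventually_linear (\<lambda>n. indeg (power_quotient scale Mg I N n)) (int (dg \<delta>))
    \<and> eventually_linear (\<lambda>n. v_number (power_quotient scale Mg I N n)) (int (dg \<delta>))"
proof -
  interpret module scale
    using assms(5) unfolding graded_module_def by blast
  obtain S where "finite S" "span S = UNIV"
    using assms(6) by blast
  then interpret noetherian_module scale
    by (rule noetherian_moduleI[OF assms(1)])
  interpret graded_operators scale Rg Mg y dg c
    using assms(1,2,5,6,13,14) by unfold_locales
  have yJ: "y j \<in> J" if "j \<in> {1..c}" for j
    unfolding assms(12) using that by (intro module.span_base[OF module_mult]) auto
  then have yI: "y j \<in> I" if "j \<in> {1..c}" for j
    using that assms(11) unfolding is_reduction_def by blast
  define A where "A = powers I UNIV"
  define B where "B = powers I N"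
  have "homogeneous_subset Mg UNIV"
    unfolding homogeneous_subset_def by simp
  then have A: "graded_family A"
    unfolding A_def using assms(10) yI by (intro graded_family_powers) auto
  have B: "graded_family B"
    unfolding B_def using assms(7,8,10) yI by (intro graded_family_powers) auto
  have BA: "B \<le> A"
    unfolding A_def B_def by (rule powers_mono) simp
  have gen: "eventually_generated (y ` {1..c}) A B"
    unfolding A_def by (rule eventually_generated_powers[OF assms(11,12)])
  note A1 = graded_familyD(1)[OF A] and B1 = graded_familyD(1)[OF B]
  have L: "power_quotient scale Mg I N n = graded_quotient scale Mg (A n) (B n)" for n
    unfolding A_def B_def by (rule power_quotient_eq)
  have L_Ass: "Ass (power_quotient scale Mg I N n) = associated A B n" for n
    unfolding L by (rule Ass_graded_quotient[OF B1])
  have L_v: "v_number_at P (power_quotient scale Mg I N n) = (INF u\<in>v_degrees P A B n. ereal (of_int u))" for P n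
    unfolding L by (rule v_number_at_graded_quotient[OF B1])
  have L_indeg: "indeg (power_quotient scale Mg I N n) = (INF u\<in>degrees A B n. ereal (of_int u))" for n
    unfolding L by (rule indeg_graded_quotient[OF A1 B1])
  let ?N = "non_nilpotent 1 A B"
  obtain Ps where Ps: "finite Ps" "\<forall>\<^sub>F n in sequentially. associated A B n = Ps"
    and lin: "\<And>P. P \<in> Ps \<Longrightarrow> \<exists>j\<in>?N. least_linear (v_degrees P A B) (int (dg j))"
    and ne: "Ps \<noteq> {} \<Longrightarrow> \<exists>\<delta>\<in>?N. \<delta> = Min ?N \<and> least_linear (degrees A B) (int (dg \<delta>)) \<and>
      (\<exists>P\<in>Ps. least_linear (v_degrees P A B) (int (dg \<delta>)))"
    using v_numbers_eventually_linear[OF A B BA gen] by blast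
  have stable: "stable_Ass scale Mg I N = Ps"
    unfolding stable_Ass_def L_Ass
  proof (rule the_equality)
    show "\<forall>\<^sub>F n in sequentially. associated A B n = Ps"
      by (rule Ps(2))
    \<comment> \<open>Two eventual values are both taken at some common \<open>n\<close>, so they
      coincide.\<close>
    fix X assume "\<forall>\<^sub>F n in sequentially. associated A B n = X"
    with Ps(2) have "\<forall>\<^sub>F n in sequentially. X = Ps"
      by eventually_elim simp
    then show "X = Ps"
      by simp
  qed
  have "non_nilpotent_indices scale I N J y c = ?N"
    unfolding A_def B_def using assms(7) yJ B[unfolded B_def] by (rule non_nilpotent_indices_eq)
  then have \<delta>_Inf: "\<delta> = Inf ?N"
    using assms(15) by simp
  \<comment> \<open>A stable prime guarantees a non-nilpotent operator, so that \<delta> is an index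
    at all.\<close>
  have "Ps \<noteq> {}"
    using assms(16) stable by simp
  from ne[OF this] obtain P where Min_in: "Min ?N \<in> ?N"
    and ind: "least_linear (degrees A B) (int (dg (Min ?N)))"
    and P: "P \<in> Ps" "least_linear (v_degrees P A B) (int (dg (Min ?N)))"
    by blast
  have \<delta>: "\<delta> = Min ?N"
    unfolding \<delta>_Inf using Min_in finite_non_nilpotent by (intro cInf_eq_Min) auto
  have \<delta>_le: "\<delta> \<le> j" if "j \<in> ?N" for j
    unfolding \<delta> using that finite_non_nilpotent by simp
  have \<delta>_in: "\<delta> \<in> {1..c}"
    using Min_in non_nilpotent_subset[of 1 A B] unfolding \<delta> by blast
  have "\<exists>a\<in>dg ` {\<delta>..c}. eventually_linear (\<lambda>n. v_number_at Q (power_quotient scale Mg I N n)) (int a)"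
    if "Q \<in> Ps" for Q
  proof -
    obtain j where j: "j \<in> ?N" "least_linear (v_degrees Q A B) (int (dg j))"
      using lin \<open>Q \<in> Ps\<close> by blast
    then have "j \<in> {\<delta>..c}"
      using \<delta>_le non_nilpotent_subset[of 1 A B] by auto
    then show ?thesis
      unfolding L_v using eventually_linear_INF[OF j(2)] by blast
  qed
  moreover have "eventually_linear (\<lambda>n. indeg (power_quotient scale Mg I N n)) (int (dg \<delta>))"
    unfolding L_indeg \<delta> using ind by (rule eventually_linear_INF)
  moreover have "eventually_linear (\<lambda>n. v_number (power_quotient scale Mg I N n)) (int (dg \<delta>))"
  proof (rule eventually_linear_cong)
    \<comment> \<open>An infimum of infima is one over the union, so the v-number too is governed by
      a single set of degrees.\<close>
    have INF_UN: "(INF Q\<in>Ps. INF u\<in>v_degrees Q A B n. ereal (of_int u)) =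
        (INF u\<in>(\<Union>Q\<in>Ps. v_degrees Q A B n). ereal (of_int u))" for n
      by (intro antisym INF_greatest) (auto intro: INF_lower2 INF_lower)
    show "\<forall>\<^sub>F n in sequentially. v_number (power_quotient scale Mg I N n) =
        (INF u\<in>(\<Union>Q\<in>Ps. v_degrees Q A B n). ereal (of_int u))"
      using Ps(2) by eventually_elim (simp add: v_number_def L_Ass L_v INF_UN)
    have "least_linear (\<lambda>n. \<Union>Q\<in>Ps. v_degrees Q A B n) (int (dg \<delta>))"
    proof (rule least_linear_UN[OF Ps(1) P(1)])
      show "least_linear (v_degrees P A B) (int (dg \<delta>))"
        unfolding \<delta> by (rule P(2))
      \<comment> \<open>Every slope belongs to a non-nilpotent operator, hence to an index not below
        \<delta>, and \<open>dg\<close> is monotone.\<close>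
      show "\<exists>a'\<ge>int (dg \<delta>). least_linear (v_degrees Q A B) a'" if Q: "Q \<in> Ps" for Q
      proof -
        obtain j where j: "j \<in> ?N" "least_linear (v_degrees Q A B) (int (dg j))"
          using lin[OF Q] by blast
        moreover have "j \<in> {1..c}"
          using j(1) non_nilpotent_subset[of 1 A B] by blast
        then have "dg \<delta> \<le> dg j"
          using dg_le \<delta>_in \<delta>_le j(1) by blast
        ultimately show ?thesis
          by (intro exI[of _ "int (dg j)"]) simp
      qed
    qed
    then show "eventually_linear (\<lambda>n. INF u\<in>(\<Union>Q\<in>Ps. v_degrees Q A B n). ereal (of_int u)) (int (dg \<delta>))"
      by (rule eventually_linear_INF)
  qed
  ultimately show ?thesis
    unfolding stable using \<delta>_in by blast
qed

end
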